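(* For all integers $n,\alpha,\beta\ge 0$, $$T_{3^{2\alpha+2}}\left(3^{2\alpha+\beta+1}(n+1)-\frac{3^{2\alpha+2}-1}{8}\right)\equiv 0\pmod{3^{3\alpha+2\beta+2}}$$ and $$T_{3^{2\alpha+2}}\left(3^{2\alpha+\beta+1}(3n+2)-\frac{3^{2\alpha+2}-1}{8}\right)\equiv 0\pmod{3^{3\alpha+2\beta+3}}.$$
   Context: $E(q^r)=\prod_{m\ge 1}(1-q^{rm})$. For a positive integer $\ell$, $T_\ell(n)$ is the number of $\ell$-regular partition triples of $n$ (no part divisible by $\ell$), defined by $\sum_{n\ge 0}T_\ell(n)q^n=\dfrac{E(q^\ell)^3}{E(q)^3}$. *)

theory Defs
  imports "HOL-Analysis.Analysis" "HOL-Number_Theory.Cong" "HOL-Computational_Algebra.Formal_Power_Series"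
begin

text \<open>
  Partitions are finite multisets of positive integers. The multiset \<open>A\<close> is a partition of
  \<^term>\<open>sum_mset A\<close>.
\<close>

definition regular_partition :: "nat \<Rightarrow> nat multiset \<Rightarrow> bool" where
  "regular_partition l A \<longleftrightarrow> (\<forall>x\<in>#A. 0 < x \<and> \<not> l dvd x)"

definition regular_triples :: "nat \<Rightarrow> nat \<Rightarrow> (nat multiset \<times> nat multiset \<times> nat multiset) set" where
  "regular_triples l n =
     {(A, B, C). regular_partition l A \<and> regular_partition l B \<and> regular_partition l C \<and>
                 sum_mset A + sum_mset B + sum_mset C = n}"

definition T :: "nat \<Rightarrow> nat \<Rightarrow> nat" where
  "T l n = card (regular_triples l n)"

text \<open>
  The theorem \<open>T_generating_function\<close> below shows that \<open>T\<close> has the expected generating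
  function, where \<open>euler_E r\<close> is \<open>E(q^r)\<close>, an infinite product in the ring of formal power
  series with its usual topology.
\<close>

definition euler_E :: "nat \<Rightarrow> 'a :: comm_ring_1 fps" where
  "euler_E r = (\<Prod>m. 1 - fps_X ^ (r * Suc m))"

lemma euler_prod_stable:
  assumes "r > 0" "k \<le> m" "m \<le> n"
  shows "fps_nth (\<Prod>i\<le>n. 1 - fps_X ^ (r * Suc i) :: 'a :: comm_ring_1 fps) k =
         fps_nth (\<Prod>i\<le>m. 1 - fps_X ^ (r * Suc i)) k"
  using assms(3)
proof (induction rule: dec_induct)
  case (step n)
  have "k < Suc (Suc n)" using step.hyps assms by simp
  also have "\<dots> \<le> r * Suc (Suc n)"
    using assms(1) mult_le_mono1[of 1 r "Suc (Suc n)"] by (simp del: mult_Suc_right)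
  finally have "k < r * Suc (Suc n)" .
  then show ?case
    using step.IH
    by (simp add: right_diff_distrib fps_X_power_mult_right_nth del: mult_Suc_right)
qed simp

lemma euler_has_prod:
  assumes "r > 0"
  shows "(\<lambda>m. 1 - fps_X ^ (r * Suc m) :: 'a :: comm_ring_1 fps) has_prod
           Abs_fps (\<lambda>k. fps_nth (\<Prod>i\<le>k. 1 - fps_X ^ (r * Suc i)) k)" (is "?f has_prod ?P")
proof -
  have "(\<lambda>n. \<Prod>i\<le>n. ?f i) \<longlonglongrightarrow> ?P"
  proof (rule tendsto_fpsI)
    fix k
    show "eventually (\<lambda>n. fps_nth (\<Prod>i\<le>n. ?f i) k = fps_nth ?P k) sequentially"
      using eventually_ge_at_top[of k]
      by eventually_elim (use euler_prod_stable[OF assms] in auto)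
  qed
  moreover have "fps_nth ?P 0 = 1"
    using assms by simp
  then have "?P \<noteq> 0"
    by (metis fps_zero_nth zero_neq_one)
  ultimately show ?thesis
    by (simp add: has_prod_def raw_has_prod_def)
qed

lemma fps_nth_euler_E:
  assumes "r > 0" "k \<le> n"
  shows "fps_nth (euler_E r :: 'a :: comm_ring_1 fps) k = fps_nth (\<Prod>i\<le>n. 1 - fps_X ^ (r * Suc i)) k"
proof -
  let ?f = "\<lambda>m. 1 - fps_X ^ (r * Suc m) :: 'a fps"
  let ?P = "Abs_fps (\<lambda>k. fps_nth (\<Prod>i\<le>k. ?f i) k)"
  have nz: "?f i \<noteq> 0" for i
  proof -
    have "fps_nth (?f i) 0 = 1" using assms(1) by simp
    then show ?thesis by (metis fps_zero_nth zero_neq_one)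
  qed
  have "p = ?P" if "?f has_prod p" for p
  proof -
    have "raw_has_prod ?f 0 p" using that nz by (auto simp: has_prod_def)
    moreover have "raw_has_prod ?f 0 ?P"
      using euler_has_prod[OF assms(1), where 'a = 'a] nz by (auto simp only: has_prod_def)
    ultimately show ?thesis
      unfolding raw_has_prod_def using LIMSEQ_unique by blast
  qed
  then have "euler_E r = ?P"
    unfolding euler_E_def prodinf_def using euler_has_prod[OF assms(1)] by (intro the_equality)
  then show ?thesis
    using euler_prod_stable[OF assms(1) order_refl assms(2), where 'a = 'a] by simp
qed

definition bounded_regular :: "nat \<Rightarrow> nat \<Rightarrow> nat \<Rightarrow> nat multiset set" where
  "bounded_regular l k n =
     {A. regular_partition l A \<and> (\<forall>x\<in>#A. x \<le> k) \<and> sum_mset A = n}"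

lemma size_le_sum_mset: "(\<forall>x\<in>#A. 0 < (x::nat)) \<Longrightarrow> size A \<le> sum_mset A"
  by (induction A) auto

lemma finite_bounded_regular: "finite (bounded_regular l k n)"
proof (rule finite_subset)
  let ?L = "{xs. set xs \<subseteq> {..k} \<and> length xs \<le> n}"
  show "bounded_regular l k n \<subseteq> mset ` ?L"
  proof
    fix A assume A: "A \<in> bounded_regular l k n"
    obtain xs where "A = mset xs" by (metis ex_mset)
    moreover have "size A \<le> n"
      using A size_le_sum_mset[of A] by (auto simp: bounded_regular_def regular_partition_def)
    ultimately show "A \<in> mset ` ?L"
      using A by (auto simp: bounded_regular_def)
  qed
  show "finite (mset ` ?L)"
    by (intro finite_imageI finite_lists_length_le) simp
qed

lemma bounded_regular_stable:
  assumes "n \<le> k"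
  shows "bounded_regular l k n = {A. regular_partition l A \<and> sum_mset A = n}"
proof -
  have "x \<le> sum_mset A" if "x \<in># A" for x :: nat and A
    using that by (metis le_add1 multi_member_split sum_mset.add_mset)
  then show ?thesis using assms by (fastforce simp: bounded_regular_def)
qed

lemma card_bounded_regular_Suc:
  assumes "\<not> l dvd Suc k"
  shows "card (bounded_regular l (Suc k) n) = card (bounded_regular l k n) +
           (if n < Suc k then 0 else card (bounded_regular l (Suc k) (n - Suc k)))"
proof -
  let ?D = "{A \<in> bounded_regular l (Suc k) n. Suc k \<in># A}"
  have split: "bounded_regular l (Suc k) n = bounded_regular l k n \<union> ?D"
    by (fastforce simp: bounded_regular_def le_Suc_eq)
  have "bounded_regular l k n \<inter> ?D = {}"
    by (force simp: bounded_regular_def)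
  then have "card (bounded_regular l (Suc k) n) = card (bounded_regular l k n) + card ?D"
    using finite_bounded_regular by (subst split, subst card_Un_disjoint) auto
  moreover have "card ?D = (if n < Suc k then 0 else card (bounded_regular l (Suc k) (n - Suc k)))"
  proof (cases "n < Suc k")
    case True
    have "?D = {}"
    proof (rule ccontr)
      assume "?D \<noteq> {}"
      then obtain A where "Suc k \<in># A" "sum_mset A = n" by (auto simp: bounded_regular_def)
      then show False using True
        by (metis leD le_add1 multi_member_split sum_mset.add_mset)
    qed
    then show ?thesis using True by (simp only: card.empty if_True)
  next
    case False
    have "bij_betw (add_mset (Suc k)) (bounded_regular l (Suc k) (n - Suc k)) ?D"
    proof (rule bij_betwI[where g = "\<lambda>A. A - {#Suc k#}"])
      show "add_mset (Suc k) \<in> bounded_regular l (Suc k) (n - Suc k) \<rightarrow> ?D"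
        using False assms by (auto simp: bounded_regular_def regular_partition_def)
      show "(\<lambda>A. A - {#Suc k#}) \<in> ?D \<rightarrow> bounded_regular l (Suc k) (n - Suc k)"
        using assms
        by (auto simp: bounded_regular_def regular_partition_def sum_mset_diff dest: in_diffD)
    qed auto
    then show ?thesis using False bij_betw_same_card by fastforce
  qed
  ultimately show ?thesis by simp
qed

lemma bounded_regular_gf:
  "Abs_fps (\<lambda>n. of_nat (card (bounded_regular l k n))) * (\<Prod>i<k. 1 - fps_X ^ Suc i) =
   (\<Prod>i | i < k \<and> l dvd Suc i. 1 - fps_X ^ Suc i :: 'a :: comm_ring_1 fps)"
proof (induction k)
  case 0
  have "bounded_regular l 0 n = (if n = 0 then {{#}} else {})" for n
    by (auto simp: bounded_regular_def regular_partition_def) (metis ex_in_conv neq0_conv set_mset_eq_empty_iff)+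
  then show ?case by (intro fps_ext) simp
next
  case (Suc k)
  let ?F = "\<lambda>k. Abs_fps (\<lambda>n. of_nat (card (bounded_regular l k n))) :: 'a fps"
  show ?case
  proof (cases "l dvd Suc k")
    case True
    have "bounded_regular l (Suc k) n = bounded_regular l k n" for n
      using True by (fastforce simp: bounded_regular_def regular_partition_def le_Suc_eq)
    then have "?F (Suc k) = ?F k" by simp
    moreover have "{i. i < Suc k \<and> l dvd Suc i} = insert k {i. i < k \<and> l dvd Suc i}"
      using True by auto
    ultimately show ?thesis
      using Suc.IH by (simp add: mult_ac del: power_Suc)
  next
    case False
    have "?F (Suc k) * (1 - fps_X ^ Suc k) = ?F k"
      by (intro fps_ext)
         (simp add: right_diff_distrib fps_X_power_mult_right_nth card_bounded_regular_Suc[OF False]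
               del: power_Suc)
    moreover have "{i. i < Suc k \<and> l dvd Suc i} = {i. i < k \<and> l dvd Suc i}"
      using False less_Suc_eq by auto
    moreover have "?F (Suc k) * (\<Prod>i<Suc k. 1 - fps_X ^ Suc i) =
       (?F (Suc k) * (1 - fps_X ^ Suc k)) * (\<Prod>i<k. 1 - fps_X ^ Suc i)"
      by (simp add: mult_ac del: power_Suc)
    ultimately show ?thesis
      using Suc.IH by simp
  qed
qed

lemma regular_gf:
  assumes "l > 0"
  shows "Abs_fps (\<lambda>n. of_nat (card {A. regular_partition l A \<and> sum_mset A = n})) * euler_E 1 =
           (euler_E l :: 'a :: comm_ring_1 fps)" (is "?F * _ = _")
proof (rule fps_ext)
  fix n
  define k where "k = l * Suc n"
  have k: "n < k"
    unfolding k_def using assms by (cases l) auto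
  let ?Fk = "Abs_fps (\<lambda>n. of_nat (card (bounded_regular l k n))) :: 'a fps"
  let ?g = "\<lambda>i. 1 - fps_X ^ Suc i :: 'a fps"
  have E1: "fps_nth (euler_E 1) i = fps_nth (\<Prod>i<k. ?g i) i" if "i \<le> n" for i
  proof -
    have "{..<k} = {..k - 1}" using k by auto
    then show ?thesis using fps_nth_euler_E[of 1 i "k - 1", where 'a = 'a] that k by simp
  qed
  have "fps_nth (?F * euler_E 1) n = fps_nth (?Fk * (\<Prod>i<k. ?g i)) n"
    unfolding fps_mult_nth using k
    by (intro sum.cong refl) (simp add: E1[unfolded One_nat_def] bounded_regular_stable del: power_Suc)
  also have "\<dots> = fps_nth (\<Prod>i | i < k \<and> l dvd Suc i. ?g i) n"
    by (simp only: bounded_regular_gf)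
  also have "(\<Prod>i | i < k \<and> l dvd Suc i. ?g i) = (\<Prod>j\<le>n. 1 - fps_X ^ (l * Suc j))"
  proof (rule prod.reindex_bij_witness[where j = "\<lambda>i. Suc i div l - 1" and i = "\<lambda>j. l * Suc j - 1"])
    fix i assume i: "i \<in> {i. i < k \<and> l dvd Suc i}"
    then obtain c where c: "Suc i = l * c" by auto
    have "l * c \<le> l * Suc n" using i by (simp add: k_def flip: c)
    then have "c \<le> Suc n" using assms by (simp del: mult_Suc_right)
    have "c > 0" using c by (cases c) auto
    then have *: "Suc (c - 1) = c" by simp
    have **: "Suc i div l = c" using c assms by simp
    show "l * Suc (Suc i div l - 1) - 1 = i" "1 - fps_X ^ (l * Suc (Suc i div l - 1)) = ?g i"
      unfolding ** * c[symmetric] by simp_all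
    show "Suc i div l - 1 \<in> {..n}"
      unfolding ** using \<open>c \<le> Suc n\<close> by simp
  next
    fix j assume j: "j \<in> {..n}"
    have *: "Suc (l * Suc j - 1) = l * Suc j" using assms by simp
    have "l * Suc j \<le> k" unfolding k_def using j by (intro mult_le_mono2) simp
    then have "l * Suc j - 1 < k" using * by linarith
    then show "l * Suc j - 1 \<in> {i. i < k \<and> l dvd Suc i}"
      unfolding mem_Collect_eq * by simp
    show "Suc (l * Suc j - 1) div l - 1 = j"
      unfolding * using assms by (simp del: mult_Suc_right)
  qed
  also have "fps_nth \<dots> n = fps_nth (euler_E l) n"
    using fps_nth_euler_E[OF assms order_refl] by metis
  finally show "fps_nth (?F * euler_E 1) n = fps_nth (euler_E l) n" .
qed

lemma card_weighted_pairs: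
  fixes v :: "'b \<Rightarrow> nat" and w :: "'c \<Rightarrow> nat"
  assumes "\<And>i. finite {a. P a \<and> v a = i}" "\<And>i. finite {b. Q b \<and> w b = i}"
  shows "finite {(a, b). P a \<and> Q b \<and> v a + w b = n}"
    and "card {(a, b). P a \<and> Q b \<and> v a + w b = n} =
           (\<Sum>i=0..n. card {a. P a \<and> v a = i} * card {b. Q b \<and> w b = n - i})"
proof -
  have eq: "{(a, b). P a \<and> Q b \<and> v a + w b = n} =
        (\<Union>i\<in>{0..n}. {a. P a \<and> v a = i} \<times> {b. Q b \<and> w b = n - i})"
    by auto
  show "finite {(a, b). P a \<and> Q b \<and> v a + w b = n}"
    unfolding eq using assms by auto
  show "card {(a, b). P a \<and> Q b \<and> v a + w b = n} =
           (\<Sum>i=0..n. card {a. P a \<and> v a = i} * card {b. Q b \<and> w b = n - i})"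
    unfolding eq
    by (subst card_UN_disjoint) (use assms in \<open>auto simp: card_cartesian_product\<close>)
qed

lemma finite_regular: "finite {A. regular_partition l A \<and> sum_mset A = n}"
  using finite_bounded_regular[of l n n] by (simp add: bounded_regular_stable)

lemma T_eq_sum:
  defines "c \<equiv> \<lambda>l n. card {A. regular_partition l A \<and> sum_mset A = n}"
  shows "T l n = (\<Sum>i=0..n. c l i * (\<Sum>j=0..n-i. c l j * c l (n - i - j)))"
proof -
  let ?Q = "\<lambda>(B, C). regular_partition l B \<and> regular_partition l C"
  let ?w = "\<lambda>(B, C). sum_mset B + sum_mset C"
  have eq: "{p. ?Q p \<and> ?w p = m} = {(B, C). regular_partition l B \<and> regular_partition l C \<and>
      sum_mset B + sum_mset C = m}" for m
    by auto
  have *: "regular_triples l n = {(A, p). regular_partition l A \<and> ?Q p \<and> sum_mset A + ?w p = n}"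
    by (auto simp: regular_triples_def)
  have fin: "finite {p. ?Q p \<and> ?w p = m}" for m
    unfolding eq by (rule card_weighted_pairs(1)[OF finite_regular finite_regular])
  show ?thesis
    unfolding T_def * c_def
    unfolding card_weighted_pairs(2)[where Q = ?Q and w = ?w, OF finite_regular fin]
    unfolding eq card_weighted_pairs(2)[OF finite_regular finite_regular] ..
qed

lemma T_gf_mult:
  assumes "l > 0"
  shows "Abs_fps (\<lambda>n. of_nat (T l n)) * euler_E 1 ^ 3 = (euler_E l ^ 3 :: 'a :: comm_ring_1 fps)"
proof -
  let ?F = "Abs_fps (\<lambda>n. of_nat (card {A. regular_partition l A \<and> sum_mset A = n})) :: 'a fps"
  have "Abs_fps (\<lambda>n. of_nat (T l n)) = ?F * (?F * ?F)"
    by (intro fps_ext) (simp add: T_eq_sum fps_mult_nth)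
  then have "Abs_fps (\<lambda>n. of_nat (T l n)) * euler_E 1 ^ 3 = (?F * euler_E 1) ^ 3"
    by (simp add: power3_eq_cube mult_ac)
  then show ?thesis
    by (simp only: regular_gf[OF assms])
qed

theorem T_generating_function:
  assumes "l > 0"
  shows "Abs_fps (\<lambda>n. of_nat (T l n)) = (euler_E l ^ 3 / euler_E 1 ^ 3 :: 'a :: field fps)"
proof -
  have "fps_nth (euler_E 1 :: 'a fps) 0 = 1"
    using fps_nth_euler_E[of 1 0 0, where 'a = 'a] by simp
  then have "(euler_E 1 :: 'a fps) ^ 3 \<noteq> 0"
    by (metis fps_zero_nth power_not_zero zero_neq_one)
  then show ?thesis
    using T_gf_mult[OF assms, where 'a = 'a] by (metis nonzero_mult_div_cancel_right)
qed

text \<open>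
  The argument of \<open>T\<close> in the congruences involves truncated subtraction and integer division
  on \<^typ>\<open>nat\<close>; neither loses anything, since the division is exact and the difference is positive.
\<close>

lemma argument_division_exact: "8 dvd (3 ^ (2 * a + 2) - 1 :: nat)"
proof -
  have "8 dvd (9 ^ k - 1 :: nat)" for k
  proof -
    have "(9::nat) ^ k mod 8 = 1"
      by (induction k) (simp_all add: mod_mult_right_eq[symmetric, of 9 _ 8])
    then show ?thesis by (metis dvd_minus_mod)
  qed
  moreover have "(3::nat) ^ (2 * a + 2) = 9 ^ Suc a"
    by (simp add: power_mult)
  ultimately show ?thesis by (simp only:)
qed

lemma argument_positive:
  fixes a b c :: nat
  assumes "c > 0"
  shows "(3 ^ (2 * a + 2) - 1) div 8 < 3 ^ (2 * a + b + 1) * c"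
proof -
  have "(3 ^ (2 * a + 2) - 1) div 8 < (3::nat) ^ (2 * a + 1)"
  proof (rule less_mult_imp_div_less)
    have "x * 9 - 1 < x * 24" if "0 < x" for x :: nat using that by linarith
    from this[of "3 ^ (2 * a)"] show "3 ^ (2 * a + 2) - 1 < (3::nat) ^ (2 * a + 1) * 8"
      by (simp add: power_add mult.commute)
  qed
  also have "\<dots> \<le> 3 ^ (2 * a + b + 1)"
    by (rule power_increasing) auto
  also have "\<dots> \<le> 3 ^ (2 * a + b + 1) * c"
    using assms by simp
  finally show ?thesis .
qed

end

theory Submission
  imports Defs
begin

text \<open>
  By Jacobi's identity, \<open>E(q)^3 = P(q^3) - 3 q E(q^9)^3\<close> for some power series \<open>P\<close>. Let
  \<open>zeta = q E(q^9)^3 / E(q)^3\<close> and \<open>tau = q E(q^3)^12 / E(q)^12\<close>, and let \<open>U\<close> keep every third coefficient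
  (written \<open>sec 0\<close> below). Taking the norm of \<open>E(q)^3\<close> over \<open>q \<mapsto> \<omega> q\<close> yields the modular equations
  \<open>zeta^3 = tau(q^3) (1 + 9 zeta + 27 zeta^2)\<close> and \<open>tau = zeta (1 + 9 zeta + 27 zeta^2)\<close>.
  Extracting the progression \<open>3^(2a+1) n - (3^(2a+2)-1)/8\<close> from the generating function of
  \<open>T_(3^(2a+2))\<close> yields a series \<open>F a\<close> (\<open>T_series a\<close> below), where
  \<open>F 0 = U zeta = 9 tau\<close> and \<open>F (a+1) = U (zeta * U (F a))\<close>.
  With \<open>x = 3 zeta\<close> and \<open>s = 27 tau\<close>, the first equation shows that \<open>U\<close> maps \<open>x \<int>[x]\<close> into \<open>s \<int>[s]\<close>, and
  the second one that \<open>s \<int>[s] \<subseteq> 9 x \<int>[x]\<close>. So on \<open>s \<int>[s]\<close> each \<open>U\<close> gains a factor 9, and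
  \<open>f \<mapsto> U (zeta f)\<close> a factor 3. The last factor 3 arises because \<open>tau\<close> is congruent modulo 3 to a
  series in the powers \<open>q^(3n+1)\<close>.
\<close>

section \<open>Precision modulo powers of X, and truncated Euler products\<close>

lemma fps_X_power_dvd_iff:
  fixes f :: "'a :: comm_ring_1 fps"
  shows "fps_X ^ n dvd f \<longleftrightarrow> (\<forall>i<n. fps_nth f i = 0)"
proof
  assume "fps_X ^ n dvd f"
  then show "\<forall>i<n. fps_nth f i = 0"
    by (auto simp: fps_X_power_mult_nth elim!: dvdE)
next
  assume *: "\<forall>i<n. fps_nth f i = 0"
  have "f = fps_X ^ n * fps_shift n f"
    by (rule fps_ext) (use * in \<open>simp add: fps_X_power_mult_nth\<close>)
  then show "fps_X ^ n dvd f"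
    by (rule dvdI)
qed

lemma dvd_mult_diff:
  fixes d :: "'a :: comm_ring_1"
  assumes "d dvd a - b" "d dvd a' - b'"
  shows "d dvd a * a' - b * b'"
proof -
  have "a * a' - b * b' = (a - b) * a' + b * (a' - b')"
    by (simp add: algebra_simps)
  then show ?thesis
    using assms by simp
qed

lemma fps_unit:
  fixes f :: "'a :: comm_ring_1 fps"
  assumes "fps_nth f 0 = 1"
  obtains g where "g * f = 1"
  using fps_left_inverse[of 1 f] assms by auto

lemma fps_nonzero:
  fixes f :: "'a :: comm_ring_1 fps"
  assumes "fps_nth f 0 = 1"
  shows "f \<noteq> 0"
  using assms by auto

definition qprod :: "nat \<Rightarrow> nat \<Rightarrow> int fps" where
  "qprod r n = (\<Prod>i<n. 1 - fps_X ^ (r * Suc i))"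

lemma qprod_0 [simp]: "qprod r 0 = 1"
  by (simp add: qprod_def)

lemma qprod_Suc: "qprod r (Suc n) = qprod r n * (1 - fps_X ^ (r * Suc n))"
  by (simp add: qprod_def)

lemma qprod_nth_0: "r > 0 \<Longrightarrow> fps_nth (qprod r n) 0 = 1"
  by (induction n) (simp_all add: qprod_Suc)

lemma fps_nth_euler_E_qprod:
  assumes "r > 0" "k < n"
  shows "fps_nth (euler_E r) k = fps_nth (qprod r n) k"
proof -
  obtain m where "n = Suc m" "k \<le> m"
    using assms(2) by (cases n) auto
  then show ?thesis
    using fps_nth_euler_E[OF assms(1), of k m] by (simp add: qprod_def lessThan_Suc_atMost)
qed

text \<open>The omitted factors are 1 modulo \<open>fps_X ^ n\<close>. Through this, identities
  proved for finite products by induction pass to infinite ones.\<close>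

lemma euler_E_approx:
  assumes "r > 0" "k \<le> n"
  shows "fps_X ^ k dvd euler_E r - qprod r n"
  using assms by (simp add: fps_X_power_dvd_iff fps_nth_euler_E_qprod[of r _ n])

lemma euler_E_nth_0: "r > 0 \<Longrightarrow> fps_nth (euler_E r :: int fps) 0 = 1"
  using fps_nth_euler_E_qprod[of r 0 1] by (simp add: qprod_nth_0)

section \<open>Jacobi's identity for the cube of Euler's product\<close>

text \<open>
  The polynomial \<open>(\<Prod>k=1..n. 1 - q^k / z) * (\<Prod>k=0..n. 1 - z * q^k)\<close> is antisymmetric under
  \<open>z \<mapsto> 1/z\<close> up to a factor \<open>-z\<close>; \<open>jacobi_coeff n j\<close> is its coefficient of \<open>z^(-j)\<close>. The weighted sums of these
  coefficients below compute the derivative at \<open>z = 1\<close>.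
\<close>

fun jacobi_coeff :: "nat \<Rightarrow> nat \<Rightarrow> int fps" where
  "jacobi_coeff 0 j = (if j = 0 then 1 else 0)"
| "jacobi_coeff (Suc n) j =
     (1 + (fps_X ^ Suc n)\<^sup>2) * jacobi_coeff n j - fps_X ^ Suc n * jacobi_coeff n (Suc j)
     - fps_X ^ Suc n * (case j of 0 \<Rightarrow> - jacobi_coeff n 0 | Suc i \<Rightarrow> jacobi_coeff n i)"

lemma jacobi_coeff_eq_0: "j > n \<Longrightarrow> jacobi_coeff n j = 0"
  by (induction n arbitrary: j) (auto split: nat.split)

text \<open>Summation by parts: the weight is linear in \<open>j\<close>, so with
  \<open>Q = q^(n+1)\<close> the neighbouring terms combine to \<open>1 - 2 Q + Q^2\<close>, up to
  boundary terms at \<open>N\<close>. At \<open>j = 0\<close> the reflected coefficient acts as the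
  weight \<open>w(-1) = -1\<close>.\<close>

lemma sum_jacobi_coeff_Suc:
  defines "w \<equiv> \<lambda>j::nat. of_nat (2 * j + 1) :: int fps"
  shows "(\<Sum>j\<le>N. w j * jacobi_coeff (Suc n) j) =
      (1 - fps_X ^ Suc n)\<^sup>2 * (\<Sum>j\<le>N. w j * jacobi_coeff n j)
      + fps_X ^ Suc n * (w (Suc N) * jacobi_coeff n N - w N * jacobi_coeff n (Suc N))"
proof (induction N)
  case 0
  show ?case
    by (simp add: w_def algebra_simps power2_eq_square del: power_Suc)
next
  case (Suc N)
  have w: "w (Suc N) = w N + 2" "w (Suc (Suc N)) = w N + 4"
    by (simp_all add: w_def)
  show ?case
    unfolding sum.atMost_Suc Suc.IH unfolding jacobi_coeff.simps w nat.case
    by (simp add: algebra_simps power2_eq_square del: power_Suc)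
qed

lemma sum_jacobi_coeff:
  "(\<Sum>j\<le>n. of_nat (2 * j + 1) * jacobi_coeff n j) = qprod 1 n ^ 2"
proof (induction n)
  case (Suc n)
  have "(\<Sum>j\<le>Suc n. of_nat (2 * j + 1) * jacobi_coeff n j) = qprod 1 n ^ 2"
    using Suc.IH by (simp add: jacobi_coeff_eq_0)
  then show ?case
    unfolding sum_jacobi_coeff_Suc
    by (simp add: jacobi_coeff_eq_0 qprod_Suc power_mult_distrib mult_ac del: power_Suc)
qed simp

definition tri :: "nat \<Rightarrow> nat" where
  "tri j = j * (j + 1) div 2"

lemma tri_0 [simp]: "tri 0 = 0"
  by (simp add: tri_def)

lemma tri_Suc: "tri (Suc j) = tri j + Suc j"
  by (simp add: tri_def)

lemma tri_ge: "j \<le> tri j"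
  by (induction j) (simp_all add: tri_Suc)

lemma strict_mono_tri: "strict_mono tri"
  by (simp add: strict_mono_Suc_iff tri_Suc)

lemma tri_eq_iff: "tri i = tri j \<longleftrightarrow> i = j"
  using strict_mono_tri by (rule strict_mono_eq)

text \<open>Algebraic core of the next induction, with \<open>a = q^j\<close> and
  \<open>b = q^(n-j)\<close>; \<open>h\<close>, \<open>h'\<close>, \<open>g\<close> are the
  coefficients at \<open>j\<close>, \<open>j+1\<close>, \<open>j-1\<close>. Over a common
  denominator the recurrence is a polynomial identity. The factor \<open>a\<close> before
  \<open>g\<close> avoids dividing \<open>q^(tri j)\<close> by \<open>q^j\<close>.\<close>

lemma jacobi_coeff_closed_step:
  fixes a b q :: "'a :: idom"
  defines "Q \<equiv> a * b * q"
  assumes "h * p * (r * (1 - a\<^sup>2 * b * q)) = s"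
      and "h' * p * (r * (1 - a\<^sup>2 * b * q) * (1 - a\<^sup>2 * b * q\<^sup>2)) = - (1 - b) * a * q * s"
      and "a * g * (p * (1 - b * q)) * r = - s"
  shows "((1 + Q\<^sup>2) * h - Q * h' - Q * g) * (p * (1 - b * q)) *
           (r * (1 - a\<^sup>2 * b * q) * (1 - a\<^sup>2 * b * q\<^sup>2)) =
         s * (1 - q\<^sup>2 * a\<^sup>2 * b\<^sup>2) * (1 - q ^ 3 * a\<^sup>2 * b\<^sup>2)"
proof -
  have "((1 + Q\<^sup>2) * h - Q * h' - Q * g) * (p * (1 - b * q)) *
           (r * (1 - a\<^sup>2 * b * q) * (1 - a\<^sup>2 * b * q\<^sup>2)) =
        (1 + Q\<^sup>2) * (h * p * (r * (1 - a\<^sup>2 * b * q))) * (1 - b * q) * (1 - a\<^sup>2 * b * q\<^sup>2)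
        - Q * (h' * p * (r * (1 - a\<^sup>2 * b * q) * (1 - a\<^sup>2 * b * q\<^sup>2))) * (1 - b * q)
        - b * q * (a * g * (p * (1 - b * q)) * r) * (1 - a\<^sup>2 * b * q) * (1 - a\<^sup>2 * b * q\<^sup>2)"
    unfolding Q_def by algebra
  also have "\<dots> = s * (1 - q\<^sup>2 * a\<^sup>2 * b\<^sup>2) * (1 - q ^ 3 * a\<^sup>2 * b\<^sup>2)"
    unfolding assms(2-4) Q_def by algebra
  finally show ?thesis .
qed

text \<open>Up to sign and \<open>q^(tri j)\<close>, the coefficient is the Gaussian binomial of
  \<open>2 n + 1\<close> over \<open>n - j\<close>, here with denominators cleared.\<close>

lemma jacobi_coeff_closed:
  assumes "j \<le> n"
  shows "jacobi_coeff n j * qprod 1 (n - j) * qprod 1 (Suc (n + j)) =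
           (-1) ^ j * fps_X ^ tri j * qprod 1 (Suc (2 * n))"
  using assms
proof (induction n arbitrary: j)
  case 0
  then show ?case by simp
next
  case (Suc n)
  define q :: "int fps" where "q = fps_X"
  note IH = Suc.IH[folded q_def]
  have qS: "qprod 1 (Suc k) = qprod 1 k * (1 - q ^ Suc k)" for k
    by (simp add: qprod_Suc q_def)
  show ?case
  proof (cases "j = Suc n")
    case True
    have *: "jacobi_coeff n n * qprod 1 (Suc (2 * n)) = (-1) ^ n * q ^ tri n * qprod 1 (Suc (2 * n))"
      using IH[of n] by (simp add: mult_2)
    then have "jacobi_coeff n n = (-1) ^ n * q ^ tri n"
      using fps_nonzero[OF qprod_nth_0[of 1 "Suc (2 * n)"]] by simp
    then show ?thesis
      unfolding True by (simp add: jacobi_coeff_eq_0 tri_Suc power_add q_def mult_ac mult_2_right)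
  next
    case False
    then obtain m where n: "n = m + j"
      using Suc.prems by (metis le_Suc_eq le_add_diff_inverse2)
    define s where "s = (-1) ^ j * q ^ tri j * qprod 1 (Suc (2 * n))"
    define g where "g = (case j of 0 \<Rightarrow> - jacobi_coeff n 0 | Suc i \<Rightarrow> jacobi_coeff n i)"
    define a where "a = q ^ j"
    define b where "b = q ^ m"
    define p where "p = qprod 1 m"
    define r where "r = qprod 1 (m + 2 * j)"
    have r1: "qprod 1 (Suc (m + 2 * j)) = r * (1 - a\<^sup>2 * b * q)"
      unfolding qS by (simp add: r_def a_def b_def power_add power_mult mult_ac power2_eq_square)
    have r2: "qprod 1 (Suc (Suc (m + 2 * j))) = r * (1 - a\<^sup>2 * b * q) * (1 - a\<^sup>2 * b * q\<^sup>2)"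
      unfolding qS[of "Suc _"] r1
      by (simp add: a_def b_def power_add power_mult mult_ac power2_eq_square)
    have p1: "qprod 1 (Suc m) = p * (1 - b * q)"
      unfolding qS by (simp add: p_def b_def mult_ac)
    have h: "jacobi_coeff n j * p * (r * (1 - a\<^sup>2 * b * q)) = s"
      using IH[of j] unfolding s_def r1[symmetric] p_def by (simp add: n mult_2 add_ac)
    \<comment> \<open>For \<open>m = 0\<close> both sides vanish: then \<open>j = n\<close>, so the
      coefficient at \<open>Suc j\<close> is zero, and \<open>b = 1\<close>.\<close>
    have h': "jacobi_coeff n (Suc j) * p * (r * (1 - a\<^sup>2 * b * q) * (1 - a\<^sup>2 * b * q\<^sup>2)) =
                - (1 - b) * a * q * s"
    proof (cases m)
      case 0
      then show ?thesis by (simp add: n jacobi_coeff_eq_0 b_def)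
    next
      case (Suc k)
      have "n - Suc j = k" "Suc (n + Suc j) = Suc (Suc (m + 2 * j))" "Suc j \<le> n"
        using n Suc by auto
      then have "jacobi_coeff n (Suc j) * qprod 1 k * qprod 1 (Suc (Suc (m + 2 * j))) =
          (-1) ^ Suc j * q ^ tri (Suc j) * qprod 1 (Suc (2 * n))"
        using IH[of "Suc j"] by (simp only:)
      moreover have "p = qprod 1 k * (1 - b)"
        unfolding p_def b_def Suc qS by simp
      ultimately have "jacobi_coeff n (Suc j) * p * qprod 1 (Suc (Suc (m + 2 * j))) =
          (-1) ^ Suc j * q ^ tri (Suc j) * qprod 1 (Suc (2 * n)) * (1 - b)"
        by (simp only: mult_ac)
      also have "\<dots> = - (1 - b) * a * q * s"
        by (simp add: s_def tri_Suc power_add a_def algebra_simps)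
      finally show ?thesis
        unfolding r2 .
    qed
    have g': "a * g * (p * (1 - b * q)) * r = - s"
    proof (cases j)
      case 0
      then show ?thesis
        using h by (simp add: a_def g_def mult_ac)
    next
      case (Suc i)
      have "n - i = Suc m" "Suc (n + i) = m + 2 * j" "i \<le> n"
        using n Suc by auto
      then have "jacobi_coeff n i * qprod 1 (Suc m) * r =
          (-1) ^ i * q ^ tri i * qprod 1 (Suc (2 * n))"
        using IH[of i] unfolding r_def by (simp only:)
      then show ?thesis
        unfolding p1 by (simp add: Suc g_def s_def a_def tri_Suc power_add mult_ac)
    qed
    have "fps_X ^ Suc n = a * b * q"
      by (simp add: n a_def b_def q_def power_add mult_ac)
    then have "jacobi_coeff (Suc n) j = (1 + (a * b * q)\<^sup>2) * jacobi_coeff n j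
        - (a * b * q) * jacobi_coeff n (Suc j) - (a * b * q) * g"
      by (simp only: jacobi_coeff.simps g_def)
    moreover have "Suc n - j = Suc m" "Suc (Suc n + j) = Suc (Suc (m + 2 * j))"
      using n by auto
    ultimately have "jacobi_coeff (Suc n) j * qprod 1 (Suc n - j) * qprod 1 (Suc (Suc n + j)) =
        s * (1 - q\<^sup>2 * a\<^sup>2 * b\<^sup>2) * (1 - q ^ 3 * a\<^sup>2 * b\<^sup>2)"
      using jacobi_coeff_closed_step[OF h h' g'] by (simp only: p1 r2)
    also have "\<dots> = (-1) ^ j * q ^ tri j * qprod 1 (Suc (2 * Suc n))"
    proof -
      have "2 * Suc n = Suc (Suc (2 * n))" by simp
      moreover have "q ^ Suc (Suc (2 * n)) = q\<^sup>2 * a\<^sup>2 * b\<^sup>2" "q ^ Suc (Suc (Suc (2 * n))) = q ^ 3 * a\<^sup>2 * b\<^sup>2"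
        by (simp_all add: n a_def b_def power_add power_mult power_mult_distrib mult_ac
              power2_eq_square power3_eq_cube)
      ultimately show ?thesis
        by (simp only: qS s_def mult.assoc)
    qed
    finally show ?thesis
      by (simp only: q_def)
  qed
qed

text \<open>The truncated products in the closed form agree with \<open>E(q)\<close> only modulo
  \<open>X^(n-j)\<close>. The factor \<open>q^(tri j)\<close> restores the lost exponent since
  \<open>j \<le> tri j\<close>, so the precision is uniform in \<open>j\<close>.\<close>

lemma jacobi_coeff_approx:
  assumes "j \<le> n"
  shows "fps_X ^ n dvd euler_E 1 * jacobi_coeff n j - (-1) ^ j * fps_X ^ tri j"
proof -
  let ?u = "qprod 1 (n - j) * qprod 1 (Suc (n + j))"
  obtain v where v: "v * ?u = 1"
    using fps_unit[of ?u] by (auto simp: qprod_nth_0)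
  let ?d = "euler_E 1 * qprod 1 (Suc (2 * n)) - ?u"
  let ?s = "(-1) ^ j * fps_X ^ tri j :: int fps"
  have "jacobi_coeff n j = jacobi_coeff n j * (v * ?u)"
    by (simp only: v mult_1_right)
  also have "\<dots> = ?s * qprod 1 (Suc (2 * n)) * v"
    unfolding jacobi_coeff_closed[OF assms, symmetric] by (simp only: mult_ac)
  finally have "euler_E 1 * jacobi_coeff n j - ?s =
      euler_E 1 * (?s * qprod 1 (Suc (2 * n)) * v) - ?s * (v * ?u)"
    by (simp only: v mult_1_right)
  also have "\<dots> = (-1) ^ j * v * (fps_X ^ tri j * ?d)"
    by (simp add: algebra_simps)
  finally have eq: "euler_E 1 * jacobi_coeff n j - ?s = (-1) ^ j * v * (fps_X ^ tri j * ?d)" .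
  have "fps_X ^ (n - j) dvd ?d"
  proof -
    have "?d = (euler_E 1 * euler_E 1 - ?u)
         - euler_E 1 * (euler_E 1 - qprod 1 (Suc (2 * n)))"
      by (simp add: algebra_simps)
    moreover have "fps_X ^ (n - j) dvd euler_E 1 * euler_E 1 - ?u"
      by (intro dvd_mult_diff euler_E_approx) auto
    moreover have "fps_X ^ (n - j) dvd euler_E 1 - qprod 1 (Suc (2 * n))"
      by (intro euler_E_approx) auto
    ultimately show ?thesis
      by (simp only: dvd_diff dvd_mult)
  qed
  then have "fps_X ^ (tri j + (n - j)) dvd fps_X ^ tri j * ?d"
    by (simp add: power_add)
  moreover have "fps_X ^ n dvd (fps_X ^ (tri j + (n - j)) :: int fps)"
    using assms tri_ge[of j] by (intro le_imp_power_dvd) linarith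
  ultimately have "fps_X ^ n dvd fps_X ^ tri j * ?d"
    by (rule dvd_trans[rotated])
  then show ?thesis
    unfolding eq by (rule dvd_mult)
qed

text \<open>Jacobi's identity modulo \<open>X^n\<close>: multiply \<open>sum_jacobi_coeff\<close> by
  \<open>E(q)\<close>, then replace each summand by its limit and \<open>qprod 1 n\<close> by
  \<open>E(q)\<close>.\<close>

lemma euler_E_cube_approx:
  "fps_X ^ n dvd euler_E 1 ^ 3 - (\<Sum>j\<le>n. of_nat (2 * j + 1) * ((-1) ^ j * fps_X ^ tri j) :: int fps)"
proof -
  let ?w = "\<lambda>j. of_nat (2 * j + 1) :: int fps"
  have eq: "euler_E 1 * qprod 1 n ^ 2 - (\<Sum>j\<le>n. ?w j * ((-1) ^ j * fps_X ^ tri j)) =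
      (\<Sum>j\<le>n. ?w j * (euler_E 1 * jacobi_coeff n j - (-1) ^ j * fps_X ^ tri j))"
    unfolding sum_jacobi_coeff[symmetric]
    by (simp add: sum_distrib_left sum_subtractf right_diff_distrib mult_ac del: of_nat_add of_nat_mult)
  have "fps_X ^ n dvd euler_E 1 * qprod 1 n ^ 2 - (\<Sum>j\<le>n. ?w j * ((-1) ^ j * fps_X ^ tri j))"
    unfolding eq by (intro dvd_sum dvd_mult jacobi_coeff_approx) auto
  moreover have "fps_X ^ n dvd euler_E 1 * (euler_E 1 * euler_E 1) - euler_E 1 * (qprod 1 n * qprod 1 n)"
    by (intro dvd_mult_diff euler_E_approx) auto
  ultimately have "fps_X ^ n dvd
      (euler_E 1 * (euler_E 1 * euler_E 1) - euler_E 1 * (qprod 1 n * qprod 1 n))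
      + (euler_E 1 * qprod 1 n ^ 2 - (\<Sum>j\<le>n. ?w j * ((-1) ^ j * fps_X ^ tri j)))"
    by (intro dvd_add)
  then show ?thesis
    by (simp add: power2_eq_square power3_eq_cube algebra_simps)
qed

lemma euler_E_cube_nth:
  "fps_nth (euler_E 1 ^ 3 :: int fps) i =
     (\<Sum>j\<le>i. if tri j = i then (-1) ^ j * (2 * int j + 1) else 0)"
proof -
  have nth: "fps_nth (of_nat w * ((-1) ^ j * fps_X ^ k)) i = (if k = i then (-1) ^ j * int w else 0)"
    for w j k
    by (cases "even j") (simp_all add: fps_X_power_nth)
  \<comment> \<open>Precision \<open>Suc i\<close> exposes coefficient \<open>i\<close>; the extra
    index \<open>j = Suc i\<close> drops out because \<open>tri (Suc i) > i\<close>.\<close>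
  have "fps_nth (euler_E 1 ^ 3 :: int fps) i =
      (\<Sum>j\<le>Suc i. if tri j = i then (-1) ^ j * (2 * int j + 1) else 0)"
  proof -
    have "fps_nth (euler_E 1 ^ 3 :: int fps) i =
        fps_nth (\<Sum>j\<le>Suc i. of_nat (2 * j + 1) * ((-1) ^ j * fps_X ^ tri j)) i"
      using euler_E_cube_approx[of "Suc i"] unfolding fps_X_power_dvd_iff fps_sub_nth right_minus_eq
      by (blast intro: lessI)
    also have "\<dots> = (\<Sum>j\<le>Suc i. if tri j = i then (-1) ^ j * int (2 * j + 1) else 0)"
      unfolding fps_sum_nth nth ..
    finally show ?thesis
      by (simp only: of_nat_add of_nat_mult of_nat_numeral of_nat_1)
  qed
  moreover have "tri (Suc i) \<noteq> i"
    using tri_ge[of "Suc i"] by linarith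
  ultimately show ?thesis by simp
qed

lemma euler_E_cube_nth_tri: "fps_nth (euler_E 1 ^ 3 :: int fps) (tri j) = (-1) ^ j * (2 * int j + 1)"
  unfolding euler_E_cube_nth using tri_ge[of j] by (simp add: tri_eq_iff)

lemma euler_E_cube_nth_other: "i \<notin> range tri \<Longrightarrow> fps_nth (euler_E 1 ^ 3 :: int fps) i = 0"
  unfolding euler_E_cube_nth by (auto intro!: sum.neutral)

section \<open>Trisection of power series\<close>

definition dil :: "int fps \<Rightarrow> int fps" where
  "dil f = f oo fps_X ^ 3"

definition sec :: "nat \<Rightarrow> int fps \<Rightarrow> int fps" where
  "sec r f = Abs_fps (\<lambda>n. fps_nth f (3 * n + r))"

lemma sec_nth [simp]: "fps_nth (sec r f) n = fps_nth f (3 * n + r)"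
  by (simp add: sec_def)

lemma dil_nth: "fps_nth (dil f) n = (if 3 dvd n then fps_nth f (n div 3) else 0)"
proof -
  have "fps_nth (dil f) n = (\<Sum>i=0..n. if n = 3 * i then fps_nth f i else 0)"
    unfolding dil_def fps_compose_nth
    by (intro sum.cong) (simp_all add: power_mult[symmetric] fps_X_power_nth)
  also have "\<dots> = (if 3 dvd n then fps_nth f (n div 3) else 0)"
  proof (cases "3 dvd n")
    case True
    then obtain k where "n = 3 * k" ..
    then show ?thesis by simp
  qed (auto intro!: sum.neutral)
  finally show ?thesis .
qed

lemma dil_mult: "dil (f * g) = dil f * dil g"
  by (simp add: dil_def fps_compose_mult_distrib)

lemma dil_power: "dil (f ^ n) = dil f ^ n"
  by (simp add: dil_def fps_compose_power)

lemma dil_add: "dil (f + g) = dil f + dil g"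
  by (simp add: dil_def fps_compose_add_distrib)

lemma dil_diff: "dil (f - g) = dil f - dil g"
  by (simp add: dil_def fps_compose_sub_distrib)

lemma dil_uminus: "dil (- f) = - dil f"
  by (simp add: dil_def fps_compose_uminus)

lemma dil_numeral: "dil (numeral k) = numeral k"
  by (simp add: dil_def)

lemma dil_1: "dil 1 = 1"
  by (simp add: dil_def)

lemma dil_X: "dil fps_X = fps_X ^ 3"
  by (simp add: dil_def)

lemmas dil_simps = dil_mult dil_power dil_add dil_diff dil_uminus dil_numeral dil_1 dil_X

lemma trisection: "f = dil (sec 0 f) + fps_X * dil (sec 1 f) + fps_X ^ 2 * dil (sec 2 f)"
proof (rule fps_ext)
  fix n :: nat
  have "n mod 3 < 3" by simp
  then consider "n mod 3 = 0" | "n mod 3 = 1" | "n mod 3 = 2" by linarith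
  then show "fps_nth f n = fps_nth (dil (sec 0 f) + fps_X * dil (sec 1 f) + fps_X ^ 2 * dil (sec 2 f)) n"
  proof cases
    case 1
    define k where "k = n div 3"
    have n: "n = 3 * k" using 1 unfolding k_def by presburger
    have "\<not> 3 dvd (3 * k - 1)" if "k > 0" using that by presburger
    moreover have "\<not> 3 dvd (3 * k - 2)" if "k > 0" using that by presburger
    ultimately show ?thesis
      by (auto simp: n dil_nth fps_X_power_mult_nth)
  next
    case 2
    define k where "k = n div 3"
    have n: "n = 3 * k + 1" using 2 unfolding k_def by presburger
    have "\<not> 3 dvd (3 * k - 1)" if "k > 0" using that by presburger
    moreover have "\<not> 3 dvd Suc (3 * k)" by presburger
    ultimately show ?thesis
      by (auto simp: n dil_nth fps_X_power_mult_nth)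
  next
    case 3
    define k where "k = n div 3"
    have n: "n = 3 * k + 2" using 3 unfolding k_def by presburger
    have "\<not> 3 dvd Suc (3 * k)" "\<not> 3 dvd Suc (Suc (3 * k))" by presburger+
    then show ?thesis
      by (auto simp: n dil_nth fps_X_power_mult_nth)
  qed
qed

lemma sec_trisection:
  assumes "f = dil a + fps_X * dil b + fps_X ^ 2 * dil c"
  shows "sec 0 f = a" "sec 1 f = b" "sec 2 f = c"
proof -
  have "fps_nth f (3 * n) = fps_nth a n \<and> fps_nth f (3 * n + 1) = fps_nth b n \<and>
        fps_nth f (3 * n + 2) = fps_nth c n" for n
  proof -
    have "\<not> 3 dvd (3 * n - 1)" "\<not> 3 dvd (3 * n - 2)" if "n > 0" using that by presburger+
    moreover have "\<not> 3 dvd Suc (3 * n)" "\<not> 3 dvd Suc (Suc (3 * n))" by presburger+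
    ultimately show ?thesis
      unfolding assms by (auto simp: dil_nth fps_X_power_mult_nth)
  qed
  then show "sec 0 f = a" "sec 1 f = b" "sec 2 f = c"
    by (simp_all add: fps_eq_iff)
qed

lemma sec_mult:
  "sec 0 (f * g) = sec 0 f * sec 0 g + fps_X * (sec 1 f * sec 2 g + sec 2 f * sec 1 g)"
  "sec 1 (f * g) = sec 0 f * sec 1 g + sec 1 f * sec 0 g + fps_X * (sec 2 f * sec 2 g)"
  "sec 2 (f * g) = sec 0 f * sec 2 g + sec 1 f * sec 1 g + sec 2 f * sec 0 g"
proof -
  have "f * g = dil (sec 0 f * sec 0 g + fps_X * (sec 1 f * sec 2 g + sec 2 f * sec 1 g))
      + fps_X * dil (sec 0 f * sec 1 g + sec 1 f * sec 0 g + fps_X * (sec 2 f * sec 2 g))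
      + fps_X ^ 2 * dil (sec 0 f * sec 2 g + sec 1 f * sec 1 g + sec 2 f * sec 0 g)"
    (is "_ = ?rhs")
  proof -
    define x where "x = (fps_X :: int fps)"
    have dil_x: "dil x = x ^ 3"
      unfolding x_def by (rule dil_X)
    have "f * g = (dil (sec 0 f) + x * dil (sec 1 f) + x ^ 2 * dil (sec 2 f)) *
        (dil (sec 0 g) + x * dil (sec 1 g) + x ^ 2 * dil (sec 2 g))"
      unfolding x_def by (intro arg_cong2[where f = "(*)"] trisection)
    also have "\<dots> = ?rhs"
      unfolding dil_mult dil_add x_def[symmetric] dil_x by algebra
    finally show ?thesis .
  qed
  note sec_trisection[OF this]
  then show
    "sec 0 (f * g) = sec 0 f * sec 0 g + fps_X * (sec 1 f * sec 2 g + sec 2 f * sec 1 g)"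
    "sec 1 (f * g) = sec 0 f * sec 1 g + sec 1 f * sec 0 g + fps_X * (sec 2 f * sec 2 g)"
    "sec 2 (f * g) = sec 0 f * sec 2 g + sec 1 f * sec 1 g + sec 2 f * sec 0 g" .
qed

lemma sec_dil: "sec 0 (dil f) = f" "sec 1 (dil f) = 0" "sec 2 (dil f) = 0"
  by (rule sec_trisection[of "dil f" f 0 0]; simp add: dil_def)+

lemma sec_X_dil: "sec 0 (fps_X * dil f) = 0" "sec 1 (fps_X * dil f) = f" "sec 2 (fps_X * dil f) = 0"
  by (rule sec_trisection[of "fps_X * dil f" 0 f 0]; simp add: dil_def)+

lemma sec_dil_mult: "sec 0 (dil f * g) = f * sec 0 g" "sec 1 (dil f * g) = f * sec 1 g"
    "sec 2 (dil f * g) = f * sec 2 g"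
  unfolding sec_mult sec_dil by simp_all

lemma sec_add: "sec r (f + g) = sec r f + sec r g"
  by (simp add: fps_eq_iff)

lemma sec_numeral_mult: "sec r (numeral k * f) = numeral k * sec r f"
  by (simp add: fps_eq_iff fps_numeral_fps_const)

lemma sec_of_int_mult: "sec r (of_int k * f) = of_int k * sec r f"
  by (simp add: fps_eq_iff)

text \<open>
  \<open>norm3 f\<close> is the norm of \<open>f\<close>, namely the product of the series \<open>f(\<omega>q)\<close> over the cube roots of
  unity \<open>\<omega>\<close>, with \<open>q^3\<close> replaced by \<open>q\<close>.
\<close>

definition norm3 :: "int fps \<Rightarrow> int fps" where
  "norm3 f = sec 0 f ^ 3 + fps_X * sec 1 f ^ 3 + fps_X ^ 2 * sec 2 f ^ 3
               - 3 * fps_X * sec 0 f * sec 1 f * sec 2 f"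

text \<open>\<open>norm3\<close> is the norm form of adjoining a cube root of \<open>X\<close>;
  after \<open>sec_mult\<close> this is a polynomial identity.\<close>

lemma norm3_mult: "norm3 (f * g) = norm3 f * norm3 g"
  unfolding norm3_def sec_mult by algebra

lemma norm3_power: "norm3 (f ^ n) = norm3 f ^ n"
proof (induction n)
  case 0
  then show ?case
    using sec_dil[of 1] by (simp add: dil_1 norm3_def)
qed (simp add: norm3_mult)

text \<open>Over the cube roots of unity, the factors \<open>1 - (\<omega> q)^m\<close> multiply to
  \<open>1 - q^(3 m)\<close> unless 3 divides \<open>m\<close>, when all three coincide. Finally
  \<open>q^3\<close> becomes \<open>q\<close>.\<close>

lemma norm3_1_minus_X_power:
  "norm3 (1 - fps_X ^ (3 * k)) = (1 - fps_X ^ k) ^ 3"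
  "norm3 (1 - fps_X ^ (3 * k + 1)) = 1 - fps_X ^ (3 * k + 1)"
  "norm3 (1 - fps_X ^ (3 * k + 2)) = 1 - fps_X ^ (3 * k + 2)"
proof -
  have 0: "dil 0 = 0"
    by (simp add: dil_def)
  have X: "dil (- (fps_X ^ k)) = - (fps_X ^ (3 * k))"
    by (simp add: dil_def fps_compose_uminus fps_X_power_compose power_mult)
  have "1 - fps_X ^ (3 * k) = dil (1 - fps_X ^ k) + fps_X * dil 0 + fps_X ^ 2 * dil 0"
    by (simp add: 0 dil_simps power_mult)
  from sec_trisection[OF this] show "norm3 (1 - fps_X ^ (3 * k)) = (1 - fps_X ^ k) ^ 3"
    by (simp add: norm3_def)
  have "1 - fps_X ^ (3 * k + 1) = dil 1 + fps_X * dil (- (fps_X ^ k)) + fps_X ^ 2 * dil 0"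
    by (simp add: 0 X dil_1)
  from sec_trisection[OF this] show "norm3 (1 - fps_X ^ (3 * k + 1)) = 1 - fps_X ^ (3 * k + 1)"
    by (simp add: norm3_def mult.commute[of 3] power_mult)
  have "1 - fps_X ^ (3 * k + 2) = dil 1 + fps_X * dil 0 + fps_X ^ 2 * dil (- (fps_X ^ k))"
    unfolding X 0 dil_1 power_add by (simp only: mult_ac) simp
  from sec_trisection[OF this] show "norm3 (1 - fps_X ^ (3 * k + 2)) = 1 - fps_X ^ (3 * k + 2)"
    unfolding norm3_def power_add by (simp add: mult.commute[of 3] power_mult mult.commute)
qed

text \<open>Exponents divisible by 3 contribute \<open>qprod 1 n ^ 3\<close>; the others contribute
  themselves, that is \<open>qprod 1 (3 * n)\<close> without the factors of
  \<open>qprod 3 n\<close>.\<close>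

lemma norm3_qprod: "norm3 (qprod 1 (3 * n)) * qprod 3 n = qprod 1 n ^ 3 * qprod 1 (3 * n)"
proof (induction n)
  case 0
  then show ?case
    using norm3_power[of _ 0] by simp
next
  case (Suc n)
  have "3 * Suc n = Suc (Suc (Suc (3 * n)))" by simp
  then have q: "qprod 1 (3 * Suc n) = qprod 1 (3 * n) *
      ((1 - fps_X ^ (3 * n + 1)) * (1 - fps_X ^ (3 * n + 2)) * (1 - fps_X ^ (3 * Suc n)))"
    by (simp only: qprod_Suc) (simp add: mult_ac del: power_Suc)
  have "n3 * (a * b * e ^ 3) * (p3 * c) = (p1 * e) ^ 3 * (p2 * (a * b * c))"
    if "n3 * p3 = p1 ^ 3 * p2" for n3 a b c e p1 p2 p3 :: "int fps"
    using that by algebra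
  from this[OF Suc.IH] show ?case
    unfolding q norm3_mult norm3_1_minus_X_power qprod_Suc[of _ n] mult_1 .
qed

lemma euler_E_triple:
  assumes "r > 0"
  shows "dil (euler_E r) = euler_E (3 * r)"
proof (rule fps_ext)
  fix n
  have "dil (qprod r k) = qprod (3 * r) k" for k
    by (induction k)
       (simp_all add: qprod_Suc dil_simps power_mult[symmetric] del: mult_Suc_right)
  then have *: "fps_nth (dil (qprod r (Suc n))) n = fps_nth (qprod (3 * r) (Suc n)) n"
    by simp
  have "fps_nth (euler_E r) (n div 3) = fps_nth (qprod r (Suc n)) (n div 3)"
    using assms by (intro fps_nth_euler_E_qprod) auto
  with * show "fps_nth (dil (euler_E r)) n = fps_nth (euler_E (3 * r)) n"
    using assms fps_nth_euler_E_qprod[of "3 * r" n "Suc n"] by (simp add: dil_nth split: if_splits)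
qed

lemma sec_dvd:
  assumes "fps_X ^ (3 * n) dvd f - g" "r < 3"
  shows "fps_X ^ n dvd sec r f - sec r g"
  using assms unfolding fps_X_power_dvd_iff by simp

lemma norm3_dvd:
  assumes "fps_X ^ (3 * n) dvd f - g"
  shows "fps_X ^ n dvd norm3 f - norm3 g"
proof -
  let ?d = "fps_X ^ n :: int fps"
  have s: "?d dvd sec 0 f - sec 0 g" "?d dvd sec 1 f - sec 1 g" "?d dvd sec 2 f - sec 2 g"
    using sec_dvd[OF assms] by auto
  have eq: "norm3 h = sec 0 h * (sec 0 h * sec 0 h) + fps_X * (sec 1 h * (sec 1 h * sec 1 h))
      + fps_X ^ 2 * (sec 2 h * (sec 2 h * sec 2 h)) - (3 * fps_X) * (sec 0 h * (sec 1 h * sec 2 h))" for h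
    by (simp add: norm3_def power3_eq_cube mult_ac)
  have add: "?d dvd (a + b) - (a' + b')" and diff: "?d dvd (a - b) - (a' - b')"
    if "?d dvd a - a'" "?d dvd b - b'" for a b a' b'
    using dvd_add[OF that] dvd_diff[OF that] by (simp_all add: algebra_simps)
  show ?thesis
    unfolding eq by (intro add diff dvd_mult_diff s) simp_all
qed

lemma norm3_euler_E: "norm3 (euler_E 1) * euler_E 3 = euler_E 1 ^ 4"
proof -
  have "fps_X ^ n dvd norm3 (euler_E 1) * euler_E 3 - euler_E 1 ^ 4" for n
  proof -
    let ?d = "fps_X ^ n :: int fps"
    have "?d dvd norm3 (euler_E 1) * euler_E 3 - norm3 (qprod 1 (3 * n)) * qprod 3 n"
      by (intro dvd_mult_diff norm3_dvd euler_E_approx) auto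
    moreover have "?d dvd (euler_E 1 * (euler_E 1 * euler_E 1)) * euler_E 1
        - (qprod 1 n * (qprod 1 n * qprod 1 n)) * qprod 1 (3 * n)"
      by (intro dvd_mult_diff euler_E_approx) auto
    ultimately have "?d dvd (norm3 (euler_E 1) * euler_E 3 - norm3 (qprod 1 (3 * n)) * qprod 3 n)
        - ((euler_E 1 * (euler_E 1 * euler_E 1)) * euler_E 1
        - (qprod 1 n * (qprod 1 n * qprod 1 n)) * qprod 1 (3 * n))"
      by (rule dvd_diff)
    then show ?thesis
      unfolding norm3_qprod by (simp add: eval_nat_numeral mult_ac)
  qed
  then have "fps_nth (norm3 (euler_E 1) * euler_E 3 - euler_E 1 ^ 4) n = 0" for n
    unfolding fps_X_power_dvd_iff by blast
  then show ?thesis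
    by (simp add: fps_eq_iff)
qed

section \<open>The 3-dissection of Euler's cube\<close>

lemma tri_mod_3:
  "tri (3 * k) mod 3 = 0" "tri (3 * k + 1) = 9 * tri k + 1" "tri (3 * k + 2) mod 3 = 0"
proof -
  show *: "tri (3 * k + 1) = 9 * tri k + 1"
  proof (induction k)
    case (Suc k)
    have "3 * Suc k + 1 = Suc (Suc (Suc (3 * k + 1)))" by simp
    then show ?case using Suc by (simp only: tri_Suc) simp
  qed (simp add: tri_def)
  have "tri (3 * k + 1) = tri (3 * k) + (3 * k + 1)" "tri (3 * k + 2) = tri (3 * k + 1) + (3 * k + 2)"
    using tri_Suc[of "3 * k"] tri_Suc[of "3 * k + 1"] by simp_all
  with * show "tri (3 * k) mod 3 = 0" "tri (3 * k + 2) mod 3 = 0"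
    by presburger+
qed

lemma tri_cases:
  obtains "tri j mod 3 = 0" | k where "tri j = 9 * tri k + 1"
proof -
  have "j = 3 * (j div 3) \<or> j = 3 * (j div 3) + 1 \<or> j = 3 * (j div 3) + 2"
    by presburger
  then show thesis
    using tri_mod_3 that by metis
qed

text \<open>No triangular number is 2 modulo 3, and those that are 1 modulo 3 arise at
  \<open>j = 3 k + 1\<close>. There \<open>2 j + 1 = 3 (2 k + 1)\<close> and the sign flips, so
  Jacobi's series reappears with the factor \<open>-3\<close>.\<close>

lemma sec_euler_E_cube:
  "sec 1 (euler_E 1 ^ 3) = - 3 * euler_E 3 ^ 3"
  "sec 2 (euler_E 1 ^ 3) = 0"
proof -
  have E3: "euler_E 3 ^ 3 = dil (euler_E 1 ^ 3)"
    using euler_E_triple[of 1] by (simp add: dil_power)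
  show "sec 2 (euler_E 1 ^ 3) = 0"
  proof (rule fps_ext)
    fix n
    have "tri j \<noteq> 3 * n + 2" for j
      by (rule tri_cases[of j]) presburger+
    then have "3 * n + 2 \<notin> range tri" by (metis rangeE)
    then show "fps_nth (sec 2 (euler_E 1 ^ 3)) n = fps_nth 0 n"
      unfolding sec_nth fps_zero_nth by (rule euler_E_cube_nth_other)
  qed
  show "sec 1 (euler_E 1 ^ 3) = - 3 * euler_E 3 ^ 3"
  proof (rule fps_ext)
    fix n
    have rhs: "fps_nth (- 3 * euler_E 3 ^ 3) n = -3 * fps_nth (dil (euler_E 1 ^ 3)) n"
      unfolding E3 by (simp add: fps_numeral_fps_const)
    show "fps_nth (sec 1 (euler_E 1 ^ 3)) n = fps_nth (- 3 * euler_E 3 ^ 3) n"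
    proof (cases "\<exists>k. n = 3 * tri k")
      case True
      then obtain k where n: "n = 3 * tri k" ..
      have "tri (3 * k + 1) = 3 * n + 1"
        unfolding n tri_mod_3(2) by simp
      then have "fps_nth (euler_E 1 ^ 3 :: int fps) (3 * n + 1) = (-1) ^ (3 * k + 1) * (2 * int (3 * k + 1) + 1)"
        using euler_E_cube_nth_tri[of "3 * k + 1"] by (simp only:)
      also have "(-1) ^ (3 * k + 1) = - ((-1 :: int) ^ k)"
        by (simp add: power_mult)
      finally show ?thesis
        unfolding rhs sec_nth using euler_E_cube_nth_tri[of k] by (simp add: n dil_nth algebra_simps)
    next
      case False
      have "tri j \<noteq> 3 * n + 1" for j
      proof (rule tri_cases[of j])
        fix k assume "tri j = 9 * tri k + 1"
        moreover have "n \<noteq> 3 * tri k" using False by blast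
        ultimately show ?thesis by linarith
      qed presburger
      then have "3 * n + 1 \<notin> range tri" by (metis rangeE)
      then have "fps_nth (euler_E 1 ^ 3 :: int fps) (3 * n + 1) = 0"
        by (rule euler_E_cube_nth_other)
      moreover have "fps_nth (dil (euler_E 1 ^ 3)) n = 0"
      proof (cases "3 dvd n")
        case True
        then have "n div 3 \<notin> range tri" using False by auto
        from euler_E_cube_nth_other[OF this] show ?thesis unfolding dil_nth by (simp only: if_cancel)
      qed (simp add: dil_nth)
      ultimately show ?thesis
        unfolding rhs sec_nth by simp
    qed
  qed
qed

section \<open>The modular equations\<close>

definition zeta :: "int fps" where
  "zeta = fps_X * euler_E 9 ^ 3 * fps_left_inverse (euler_E 1 ^ 3) 1"

definition tau :: "int fps" where
  "tau = fps_X * euler_E 3 ^ 12 * fps_left_inverse (euler_E 1 ^ 12) 1"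

lemma euler_E_power_nth_0: "r > 0 \<Longrightarrow> fps_nth (euler_E r ^ n :: int fps) 0 = 1"
  by (simp add: fps_power_zeroth euler_E_nth_0)

lemma left_inverse_euler_E: "fps_left_inverse (euler_E 1 ^ n) 1 * euler_E 1 ^ n = (1 :: int fps)"
  by (rule fps_left_inverse) (simp add: euler_E_power_nth_0)

lemma euler_E_nonzero: "r > 0 \<Longrightarrow> euler_E r \<noteq> (0 :: int fps)"
  by (rule fps_nonzero) (rule euler_E_nth_0)

lemma zeta_eq: "zeta * euler_E 1 ^ 3 = fps_X * euler_E 9 ^ 3"
  unfolding zeta_def by (simp only: mult.assoc left_inverse_euler_E mult_1_right)

lemma tau_eq: "tau * euler_E 1 ^ 12 = fps_X * euler_E 3 ^ 12"
  unfolding tau_def by (simp only: mult.assoc left_inverse_euler_E mult_1_right)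

lemma dil_euler_E: "dil (euler_E 1) = euler_E 3" "dil (euler_E 3) = euler_E 9"
  by (simp_all add: euler_E_triple[of 1, unfolded One_nat_def] euler_E_triple)

definition jacobi_part :: "int fps" where
  "jacobi_part = sec 0 (euler_E 1 ^ 3)"

lemma dil_jacobi_part: "dil jacobi_part = euler_E 1 ^ 3 + 3 * fps_X * euler_E 9 ^ 3"
proof -
  have "euler_E 1 ^ 3 = dil jacobi_part + fps_X * dil (sec 1 (euler_E 1 ^ 3))
      + fps_X ^ 2 * dil (sec 2 (euler_E 1 ^ 3))"
    unfolding jacobi_part_def by (rule trisection)
  moreover have "dil (- 3 * euler_E 3 ^ 3) = - 3 * euler_E 9 ^ 3"
    by (simp add: dil_simps dil_euler_E)
  ultimately show ?thesis
    unfolding sec_euler_E_cube by (simp add: dil_def algebra_simps)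
qed

text \<open>The norm of \<open>E(q)^3\<close> read off its trisection; it is also the determinant of
  the linear system for the \<open>sec r zeta\<close>. Computing the same norm from the product
  gives \<open>discr_eq\<close>.\<close>

definition discr :: "int fps" where
  "discr = jacobi_part ^ 3 - 27 * fps_X * euler_E 3 ^ 9"

lemma discr_eq: "discr * euler_E 3 ^ 3 = euler_E 1 ^ 12"
proof -
  have "norm3 (euler_E 1 ^ 3) = discr"
    unfolding norm3_def sec_euler_E_cube discr_def jacobi_part_def[symmetric]
    by (simp add: power_mult_distrib flip: power_mult)
  then have "discr * euler_E 3 ^ 3 = (norm3 (euler_E 1) * euler_E 3) ^ 3"
    by (simp only: norm3_power power_mult_distrib)
  then show ?thesis
    unfolding norm3_euler_E by (simp flip: power_mult)
qed

lemma discr_nonzero: "discr \<noteq> 0"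
  using discr_eq euler_E_nonzero[of 1] by fastforce

lemma tau_discr: "tau * discr = fps_X * euler_E 3 ^ 9"
proof -
  have "tau * discr * euler_E 3 ^ 3 = fps_X * euler_E 3 ^ 9 * euler_E 3 ^ 3"
    using tau_eq by (simp only: mult.assoc discr_eq) (simp flip: power_add)
  then show ?thesis
    using euler_E_nonzero[of 3] by simp
qed

text \<open>With \<open>b = zeta c\<close> the cube of \<open>3 b\<close> cancels in
  \<open>(c + 3 b)^3 - 27 b^3\<close>, leaving the quadratic factor shared by both modular
  equations.\<close>

lemma dil_discr: "dil discr = euler_E 1 ^ 9 * (1 + 9 * zeta + 27 * zeta\<^sup>2)"
proof -
  define c where "c = (euler_E 1 ^ 3 :: int fps)"
  define b :: "int fps" where "b = fps_X * euler_E 9 ^ 3"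
  have b: "b = zeta * c"
    unfolding b_def c_def by (rule zeta_eq[symmetric])
  have "dil discr = (c + 3 * b) ^ 3 - 27 * b ^ 3"
    unfolding discr_def dil_simps dil_jacobi_part dil_euler_E b_def c_def
    by (simp add: power_mult_distrib mult.assoc flip: power_mult)
  also have "\<dots> = c ^ 3 * (1 + 9 * zeta + 27 * zeta\<^sup>2)"
    unfolding b by algebra
  finally show ?thesis
    by (simp add: c_def flip: power_mult)
qed

text \<open>Dilating \<open>discr_eq\<close> rewrites the numerator \<open>E(q^3)^12\<close> of
  \<open>tau\<close> as \<open>dil discr\<close> times \<open>E(q^9)^3\<close>.\<close>

lemma tau_zeta: "tau = zeta * (1 + 9 * zeta + 27 * zeta\<^sup>2)"
proof -
  have "euler_E 3 ^ 12 = dil discr * euler_E 9 ^ 3"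
    using arg_cong[OF discr_eq, of dil] by (simp only: dil_simps dil_euler_E)
  then have "tau * euler_E 1 ^ 12 = (fps_X * euler_E 9 ^ 3) * dil discr"
    unfolding tau_eq by (simp only: mult_ac)
  also have "\<dots> = zeta * (1 + 9 * zeta + 27 * zeta\<^sup>2) * (euler_E 1 ^ 3 * euler_E 1 ^ 9)"
    unfolding zeta_eq[symmetric] dil_discr by (simp only: mult_ac)
  finally show ?thesis
    using euler_E_nonzero[of 1] by (simp flip: power_add)
qed

text \<open>Dilating \<open>tau_discr\<close> makes its right-hand side the cube of
  \<open>q E(q^9)^3 = zeta E(q)^3\<close>.\<close>

lemma zeta_cube: "zeta ^ 3 = dil tau * (1 + 9 * zeta + 27 * zeta\<^sup>2)"
proof -
  have "dil tau * dil discr = fps_X ^ 3 * euler_E 9 ^ 9"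
    using arg_cong[OF tau_discr, of dil] by (simp only: dil_simps dil_euler_E)
  also have "\<dots> = (zeta * euler_E 1 ^ 3) ^ 3"
    unfolding zeta_eq by (simp add: power_mult_distrib flip: power_mult)
  finally have "dil tau * (1 + 9 * zeta + 27 * zeta\<^sup>2) * euler_E 1 ^ 9 = zeta ^ 3 * euler_E 1 ^ 9"
    unfolding dil_discr power_mult_distrib by (simp add: mult_ac flip: power_mult)
  then show ?thesis
    using euler_E_nonzero[of 1] by simp
qed

section \<open>Trisection of zeta and of its square\<close>

lemma sec_zeta_equations:
  "sec 0 zeta * jacobi_part = 3 * fps_X * euler_E 3 ^ 3 * sec 2 zeta"
  "sec 1 zeta * jacobi_part = euler_E 3 ^ 3 * (1 + 3 * sec 0 zeta)"
  "sec 2 zeta * jacobi_part = 3 * euler_E 3 ^ 3 * sec 1 zeta"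
proof -
  \<comment> \<open>The product lies in residue class 1 only, so trisecting it gives a cyclic linear
    system, solved by Cramer's rule below.\<close>
  have rhs: "zeta * euler_E 1 ^ 3 = fps_X * dil (euler_E 3 ^ 3)"
    unfolding zeta_eq by (simp add: dil_power dil_euler_E)
  note * = sec_mult[of zeta "euler_E 1 ^ 3", unfolded rhs sec_X_dil sec_euler_E_cube, folded jacobi_part_def]
  show "sec 0 zeta * jacobi_part = 3 * fps_X * euler_E 3 ^ 3 * sec 2 zeta"
    using *(1) by (simp add: algebra_simps)
  show "sec 1 zeta * jacobi_part = euler_E 3 ^ 3 * (1 + 3 * sec 0 zeta)"
    using *(2) by (simp add: algebra_simps)
  show "sec 2 zeta * jacobi_part = 3 * euler_E 3 ^ 3 * sec 1 zeta"
    using *(3) by (simp add: algebra_simps)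
qed

lemma cyclic_system_solution:
  fixes p b x z0 z1 z2 :: "'a :: idom"
  assumes "z0 * p = 3 * x * b * z2" "z1 * p = b * (1 + 3 * z0)" "z2 * p = 3 * b * z1"
  shows "z0 * (p ^ 3 - 27 * x * b ^ 3) = 9 * x * b ^ 3"
    and "z1 * (p ^ 3 - 27 * x * b ^ 3) = b * p\<^sup>2"
    and "z2 * (p ^ 3 - 27 * x * b ^ 3) = 3 * b\<^sup>2 * p"
proof -
  show "z0 * (p ^ 3 - 27 * x * b ^ 3) = 9 * x * b ^ 3"
    using assms by algebra
  show "z1 * (p ^ 3 - 27 * x * b ^ 3) = b * p\<^sup>2"
    using assms by algebra
  show "z2 * (p ^ 3 - 27 * x * b ^ 3) = 3 * b\<^sup>2 * p"
    using assms by algebra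
qed

lemma sec_zeta_discr:
  "sec 0 zeta * discr = 9 * (fps_X * euler_E 3 ^ 9)"
  "sec 1 zeta * discr = euler_E 3 ^ 3 * jacobi_part\<^sup>2"
  "sec 2 zeta * discr = 3 * euler_E 3 ^ 6 * jacobi_part"
  using cyclic_system_solution[OF sec_zeta_equations]
  by (simp_all add: discr_def flip: power_mult)

lemma sec_0_zeta: "sec 0 zeta = 9 * tau"
proof -
  have "sec 0 zeta * discr = 9 * tau * discr"
    unfolding sec_zeta_discr tau_discr[symmetric] by (simp only: mult_ac)
  then show ?thesis
    using discr_nonzero by simp
qed

lemma sec_0_zeta_square: "sec 0 (zeta\<^sup>2) = 6 * tau + 243 * tau\<^sup>2"
proof -
  have p: "jacobi_part ^ 3 = discr * (1 + 27 * tau)"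
  proof -
    have "discr * (1 + 27 * tau) = discr + 27 * (tau * discr)"
      by (simp add: algebra_simps)
    then show ?thesis
      unfolding tau_discr by (simp add: discr_def algebra_simps)
  qed
  \<comment> \<open>The square needs only the product of parts 1 and 2, in which
    \<open>jacobi_part\<close> occurs cubed and is thus expressible by \<open>discr\<close> and
    \<open>tau\<close>.\<close>
  have "fps_X * (sec 1 zeta * sec 2 zeta) * discr\<^sup>2 =
      3 * (fps_X * (euler_E 3 ^ 3 * euler_E 3 ^ 6)) * jacobi_part ^ 3"
    using sec_zeta_discr(2,3) by algebra
  also have "\<dots> = 3 * tau * (1 + 27 * tau) * discr\<^sup>2"
  proof -
    have "fps_X * (euler_E 3 ^ 3 * euler_E 3 ^ 6) = tau * discr"
      unfolding tau_discr by (simp flip: power_add)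
    then show ?thesis
      unfolding p by algebra
  qed
  finally have "fps_X * (sec 1 zeta * sec 2 zeta) = 3 * tau * (1 + 27 * tau)"
    using discr_nonzero by simp
  then show ?thesis
    unfolding power2_eq_square sec_mult sec_0_zeta by algebra
qed

text \<open>Modulo 3, \<open>tau\<close> agrees with \<open>zeta\<close>, whose part in class 2 is
  divisible by 3 because \<open>discr\<close> is invertible over the integers.\<close>

lemma three_dvd_sec_2_tau: "3 dvd fps_nth tau (3 * n + 2)"
proof -
  have "fps_nth discr 0 = 1"
    using arg_cong[OF discr_eq, of "\<lambda>f. fps_nth f 0"]
    by (simp add: euler_E_power_nth_0)
  then obtain u where u: "u * discr = 1"
    by (rule fps_unit)
  have "sec 2 zeta = 3 * (u * (euler_E 3 ^ 6 * jacobi_part))"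
    using sec_zeta_discr(3) u by algebra
  moreover have "tau = zeta + 3 * (3 * zeta\<^sup>2 + 9 * zeta ^ 3)"
    unfolding tau_zeta by algebra
  from arg_cong[OF this, of "sec 2"]
  have "sec 2 tau = sec 2 zeta + 3 * sec 2 (3 * zeta\<^sup>2 + 9 * zeta ^ 3)"
    by (simp only: sec_add sec_numeral_mult)
  ultimately have "sec 2 tau = 3 * (u * (euler_E 3 ^ 6 * jacobi_part) + sec 2 (3 * zeta\<^sup>2 + 9 * zeta ^ 3))"
    by (simp only: distrib_left)
  then have "fps_nth (sec 2 tau) n = 3 * fps_nth (u * (euler_E 3 ^ 6 * jacobi_part) + sec 2 (3 * zeta\<^sup>2 + 9 * zeta ^ 3)) n"
    by (simp only: fps_numeral_fps_const fps_mult_left_const_nth)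
  then show ?thesis
    by simp
qed

section \<open>Divisibility by powers of three\<close>

inductive_set int_span :: "int fps \<Rightarrow> int fps set" for x where
  power: "x ^ Suc k \<in> int_span x"
| add: "f \<in> int_span x \<Longrightarrow> g \<in> int_span x \<Longrightarrow> f + g \<in> int_span x"
| scale: "f \<in> int_span x \<Longrightarrow> of_int c * f \<in> int_span x"

lemma int_span_self: "x \<in> int_span x"
  using int_span.power[of x 0] by simp

lemma int_span_numeral: "f \<in> int_span x \<Longrightarrow> numeral k * f \<in> int_span x"
  using int_span.scale[of f x "numeral k"] by simp

lemma int_span_mult_self: "f \<in> int_span x \<Longrightarrow> x * f \<in> int_span x"
proof (induction rule: int_span.induct)
  case (power k)
  then show ?case using int_span.power[of x "Suc k"] by simp
next
  case (add f g)
  then show ?case by (simp add: distrib_left int_span.add)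
next
  case (scale f c)
  then show ?case using int_span.scale[of "x * f" x c] by (simp add: mult_ac)
qed

lemma int_span_sec_0:
  assumes "\<And>k. sec 0 (x ^ Suc k) \<in> int_span y" "f \<in> int_span x"
  shows "sec 0 f \<in> int_span y"
  using assms(2)
  by induction (auto simp: assms(1) sec_add sec_of_int_mult intro: int_span.add int_span.scale
                     simp del: power_Suc)

text \<open>The scaled equation \<open>x^3 = s(q^3) (1 + 3 x + 3 x^2)\<close> yields a recurrence
  for \<open>sec 0\<close> of the powers of \<open>x\<close>, since \<open>s(q^3)\<close> leaves
  \<open>sec 0\<close> as \<open>s\<close>. The values for \<open>zeta\<close> and
  \<open>zeta^2\<close> start it.\<close>

lemma sec_0_zeta_power: "sec 0 ((3 * zeta) ^ Suc k) \<in> int_span (27 * tau)"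
proof (induction k rule: less_induct)
  case (less k)
  define x where "x = 3 * zeta"
  define s where "s = 27 * tau"
  have s: "s \<in> int_span s"
    by (rule int_span_self)
  have 1: "sec 0 x = s"
    by (simp add: x_def s_def sec_numeral_mult sec_0_zeta)
  have "sec 0 (x ^ 2) = 9 * sec 0 (zeta\<^sup>2)"
    by (simp add: x_def power_mult_distrib sec_numeral_mult)
  also have "\<dots> = 2 * s + 3 * (s * s)"
    unfolding sec_0_zeta_square s_def by algebra
  finally have 2: "sec 0 (x ^ 2) = 2 * s + 3 * (s * s)" .
  have "x ^ 3 = dil s * (1 + 3 * x + 3 * x\<^sup>2)"
    unfolding x_def s_def dil_simps using zeta_cube by algebra
  then have "x ^ (j + 3) = dil s * (x ^ j + 3 * x ^ Suc j + 3 * x ^ Suc (Suc j))" for j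
    by (simp add: power_add algebra_simps power2_eq_square)
  then have rec: "sec 0 (x ^ (j + 3)) =
      s * (sec 0 (x ^ j) + 3 * sec 0 (x ^ Suc j) + 3 * sec 0 (x ^ Suc (Suc j)))" for j
    by (simp only: sec_dil_mult sec_add sec_numeral_mult)
  note IH = less.IH[folded x_def s_def]
  consider "k = 0" | "k = 1" | j where "k = j + 2"
    by (metis One_nat_def add_2_eq_Suc' not0_implies_Suc)
  then have "sec 0 (x ^ Suc k) \<in> int_span s"
  proof cases
    case 1
    then show ?thesis using \<open>sec 0 x = s\<close> s by simp
  next
    case k: 2
    have "sec 0 (x ^ Suc k) = 2 * s + 3 * (s * s)"
      using 2 by (simp add: k numeral_2_eq_2)
    then show ?thesis
      by (auto intro!: int_span.add int_span_numeral int_span_mult_self s)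
  next
    case k: 3
    have *: "3 * sec 0 (x ^ Suc j) \<in> int_span s" "3 * sec 0 (x ^ Suc (Suc j)) \<in> int_span s"
      using k by (auto intro!: int_span_numeral IH simp del: power_Suc)
    \<comment> \<open>For \<open>j = 0\<close> the value \<open>sec 0 1 = 1\<close> is outside the
      span, but the factor \<open>s\<close> brings it in.\<close>
    have "s * sec 0 (x ^ j) \<in> int_span s"
    proof (cases j)
      case 0
      then show ?thesis using sec_dil(1)[of 1] s by (simp add: dil_1)
    next
      case (Suc i)
      then show ?thesis using k by (auto intro!: int_span_mult_self IH simp del: power_Suc)
    qed
    moreover have "sec 0 (x ^ Suc k) = s * sec 0 (x ^ j) +
        s * (3 * sec 0 (x ^ Suc j) + 3 * sec 0 (x ^ Suc (Suc j)))"
      using rec[of j] by (simp only: k add_Suc_right[symmetric] distrib_left add.assoc) simp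
    ultimately show ?thesis
      using * by (auto intro!: int_span.add int_span_mult_self)
  qed
  then show ?case
    by (simp only: x_def s_def)
qed

text \<open>
  In terms of \<open>x = 3 * zeta\<close> the modular equation reads \<open>27 * tau = 9 * (x + 3 * x^2 + 3 * x^3)\<close>,
  which is where all the factors of 9 come from.
\<close>

lemma int_span_tau_zeta:
  assumes "f \<in> int_span (27 * tau)"
  shows "\<exists>g\<in>int_span (3 * zeta). f = 9 * g"
  using assms
proof induction
  case (power k)
  define x where "x = 3 * zeta"
  have x: "x \<in> int_span x"
    by (rule int_span_self)
  have tau: "27 * tau = 9 * (x + x * (3 * x) + x * (x * (3 * x)))"
    unfolding tau_zeta x_def by algebra
  have "\<exists>g\<in>int_span x. (27 * tau) ^ Suc k = 9 * g"
  proof (induction k)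
    case 0
    show ?case
      by (rule bexI[of _ "x + x * (3 * x) + x * (x * (3 * x))"])
         (auto simp: tau intro!: int_span.add int_span_mult_self int_span_numeral x)
  next
    case (Suc k)
    then obtain g where g: "g \<in> int_span x" "(27 * tau) ^ Suc k = 9 * g" by blast
    have "(27 * tau) ^ Suc (Suc k) = 9 * (9 * (x * g + x * (3 * (x * g)) + x * (x * (3 * (x * g)))))"
      unfolding power_Suc[of _ "Suc k"] g(2) unfolding tau by algebra
    then show ?case
      using g(1)
      by (intro bexI[of _ "9 * (x * g + x * (3 * (x * g)) + x * (x * (3 * (x * g))))"])
         (auto intro!: int_span.add int_span_mult_self int_span_numeral)
  qed
  then show ?case
    by (simp only: x_def)
next
  case (add f g)
  then obtain f' g' where "f' \<in> int_span (3 * zeta)" "f = 9 * f'" "g' \<in> int_span (3 * zeta)" "g = 9 * g'"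
    by blast
  then show ?case
    by (intro bexI[of _ "f' + g'"]) (auto intro: int_span.add)
next
  case (scale f c)
  then obtain f' where "f' \<in> int_span (3 * zeta)" "f = 9 * f'"
    by blast
  then show ?case
    by (intro bexI[of _ "of_int c * f'"]) (auto intro: int_span.scale)
qed

text \<open>The 9 is split off in terms of \<open>3 * zeta\<close>; \<open>sec 0\<close> sends the
  cofactor, also after multiplication by \<open>3 * zeta\<close>, back to polynomials in
  \<open>27 * tau\<close>.\<close>

lemma sec_0_int_span:
  assumes "f \<in> int_span (27 * tau)"
  shows "\<exists>g\<in>int_span (27 * tau). sec 0 f = 9 * g"
    and "\<exists>g\<in>int_span (27 * tau). sec 0 (3 * zeta * f) = 9 * g"
proof -
  obtain g where g: "g \<in> int_span (3 * zeta)" "f = 9 * g"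
    using int_span_tau_zeta[OF assms] by blast
  have "sec 0 f = 9 * sec 0 g" "sec 0 (3 * zeta * f) = 9 * sec 0 (3 * zeta * g)"
    by (simp_all only: g(2) sec_numeral_mult mult.left_commute[of _ 9])
  moreover have "sec 0 g \<in> int_span (27 * tau)" "sec 0 (3 * zeta * g) \<in> int_span (27 * tau)"
    using g(1) by (intro int_span_sec_0[OF sec_0_zeta_power] int_span_mult_self; assumption)+
  ultimately show "\<exists>g\<in>int_span (27 * tau). sec 0 f = 9 * g"
      "\<exists>g\<in>int_span (27 * tau). sec 0 (3 * zeta * f) = 9 * g"
    by blast+
qed

text \<open>This is \<open>3^e / 27\<close> times the span, with the denominator cleared; the
  scaling puts \<open>tau\<close> itself into \<open>lattice 0\<close>.\<close>

definition lattice :: "nat \<Rightarrow> int fps set" where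
  "lattice e = {f. \<exists>g\<in>int_span (27 * tau). 27 * f = 3 ^ e * g}"

lemma sec_0_lattice:
  assumes "f \<in> lattice e"
  shows "sec 0 f \<in> lattice (e + 2)"
proof -
  obtain g where g: "g \<in> int_span (27 * tau)" "27 * f = 3 ^ e * g"
    using assms by (auto simp: lattice_def)
  obtain h where h: "h \<in> int_span (27 * tau)" "sec 0 g = 9 * h"
    using sec_0_int_span(1)[OF g(1)] by blast
  have "27 * sec 0 f = sec 0 (27 * f)"
    by (simp only: sec_numeral_mult)
  also have "\<dots> = sec 0 (of_int (3 ^ e) * g)"
    by (simp add: g(2))
  also have "\<dots> = 3 ^ (e + 2) * h"
    unfolding sec_of_int_mult h(2) by (simp add: power_add)
  finally show ?thesis
    using h(1) by (auto simp: lattice_def)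
qed

text \<open>\<open>zeta\<close> is a third of \<open>3 * zeta\<close>, so one of the two powers of 3
  gained is given back.\<close>

lemma sec_0_zeta_lattice:
  assumes "f \<in> lattice e"
  shows "sec 0 (zeta * f) \<in> lattice (e + 1)"
proof -
  obtain g where g: "g \<in> int_span (27 * tau)" "27 * f = 3 ^ e * g"
    using assms by (auto simp: lattice_def)
  obtain h where h: "h \<in> int_span (27 * tau)" "sec 0 (3 * zeta * g) = 9 * h"
    using sec_0_int_span(2)[OF g(1)] by blast
  have "3 * (27 * sec 0 (zeta * f)) = sec 0 (3 * zeta * (27 * f))"
    by (simp only: sec_numeral_mult mult.assoc mult.left_commute[of zeta])
  also have "\<dots> = sec 0 (of_int (3 ^ e) * (3 * zeta * g))"
    unfolding g(2) by (simp add: mult_ac)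
  also have "\<dots> = 3 * (3 ^ (e + 1) * h)"
    unfolding sec_of_int_mult h(2) by (simp add: power_add)
  finally have "27 * sec 0 (zeta * f) = 3 ^ (e + 1) * h"
    unfolding mult_cancel_left by simp
  then show ?thesis
    using h(1) by (auto simp: lattice_def)
qed

text \<open>Higher powers of \<open>27 * tau\<close> are divisible by \<open>27^2\<close>, so modulo
  81 only a multiple of \<open>27 * tau\<close> survives. The extra 3 then comes from
  \<open>three_dvd_sec_2_tau\<close>.\<close>

lemma lattice_nth:
  assumes "f \<in> lattice e"
  shows "3 ^ e dvd fps_nth f n" and "3 ^ (e + 1) dvd fps_nth f (3 * n + 2)"
proof -
  obtain g where g: "g \<in> int_span (27 * tau)" "27 * f = 3 ^ e * g"
    using assms by (auto simp: lattice_def)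
  from g(1) have "\<exists>d r. g = 27 * (of_int d * tau + 3 * r)"
  proof induction
    case (power k)
    show ?case
    proof (cases k)
      case 0
      then show ?thesis by (intro exI[of _ 1] exI[of _ 0]) simp
    next
      case (Suc j)
      then show ?thesis
        by (intro exI[of _ 0] exI[of _ "9 * tau ^ 2 * (27 * tau) ^ j"]) (simp add: power2_eq_square)
    qed
  next
    case (add f g)
    then obtain d r d' r' where "f = 27 * (of_int d * tau + 3 * r)" "g = 27 * (of_int d' * tau + 3 * r')"
      by blast
    then show ?case
      by (intro exI[of _ "d + d'"] exI[of _ "r + r'"]) (simp add: algebra_simps)
  next
    case (scale f c)
    then obtain d r where "f = 27 * (of_int d * tau + 3 * r)"
      by blast
    then show ?case
      by (intro exI[of _ "c * d"] exI[of _ "of_int c * r"]) (simp add: algebra_simps)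
  qed
  then obtain d r where "g = 27 * (of_int d * tau + 3 * r)"
    by blast
  then have "27 * f = 27 * (of_int (3 ^ e) * (of_int d * tau + 3 * r))"
    using g(2) by simp
  then have f: "f = of_int (3 ^ e) * (of_int d * tau + of_int 3 * r)"
    by simp
  have nth: "fps_nth f m = 3 ^ e * (d * fps_nth tau m + 3 * fps_nth r m)" for m
    unfolding f by (simp only: fps_mult_of_int_nth fps_add_nth) simp
  show "3 ^ e dvd fps_nth f n"
    unfolding nth by simp
  have "3 dvd d * fps_nth tau (3 * n + 2) + 3 * fps_nth r (3 * n + 2)"
    using three_dvd_sec_2_tau[of n] by simp
  then show "3 ^ (e + 1) dvd fps_nth f (3 * n + 2)"
    unfolding nth power_add power_one_right by (rule mult_dvd_mono[OF dvd_refl])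
qed

section \<open>Progressions of coefficients\<close>

text \<open>The shift by \<open>fps_X\<close> pulls index \<open>n\<close> back to
  \<open>3 n - 1\<close>, and each later step puts \<open>9 n - 3\<close> in place of
  \<open>n\<close>. The offsets 1 and \<open>k \<mapsto> 9 k + 1\<close> give
  \<open>(3^(2 a + 2) - 1) / 8\<close>.\<close>

primrec progression :: "nat \<Rightarrow> int fps \<Rightarrow> int fps" where
  "progression 0 f = sec 0 (fps_X * f)"
| "progression (Suc a) f = sec 0 (fps_X * sec 0 (progression a f))"

lemma progression_nth:
  "fps_nth (progression a f) n =
     (if n = 0 then 0 else fps_nth f (3 ^ (2 * a + 1) * n - (3 ^ (2 * a + 2) - 1) div 8))"
proof (induction a arbitrary: n)
  case 0
  then show ?case by simp
next
  case (Suc a)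
  show ?case
  proof (cases "n = 0")
    case False
    obtain k where k: "(3::nat) ^ (2 * a + 2) - 1 = 8 * k"
      using argument_division_exact[of a] by (auto elim: dvdE)
    have p: "(3::nat) ^ (2 * a + 2) = 8 * k + 1"
    proof -
      have "(3::nat) ^ (2 * a + 2) > 0" by simp
      with k show ?thesis by linarith
    qed
    have p1: "3 * (3::nat) ^ (2 * a + 1) = 8 * k + 1"
      using p by simp
    have p2: "(3::nat) ^ (2 * Suc a + 2) = 9 * (8 * k + 1)" "(3::nat) ^ (2 * Suc a + 1) = 3 * (8 * k + 1)"
      unfolding p[symmetric] by simp_all
    have "fps_nth (progression (Suc a) f) n = fps_nth (progression a f) (3 * (3 * n - 1))"
      using False by simp
    also have "\<dots> = fps_nth f (3 ^ (2 * a + 1) * (3 * (3 * n - 1)) - k)"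
      unfolding Suc.IH k using False by simp
    also have "3 ^ (2 * a + 1) * (3 * (3 * n - 1)) - k = 3 * (8 * k + 1) * n - (9 * (8 * k + 1) - 1) div 8"
    proof -
      have "3 ^ (2 * a + 1) * (3 * (3 * n - 1)) = (8 * k + 1) * (3 * n - 1)"
        unfolding p1[symmetric] by simp
      also have "\<dots> = (8 * k + 1) * (3 * n) - (8 * k + 1)"
        by (simp only: diff_mult_distrib2 mult_1_right)
      also have "\<dots> = 3 * (8 * k + 1) * n - (8 * k + 1)"
        by (simp only: mult_ac)
      moreover have "(9 * (8 * k + 1) - 1) div 8 = 9 * k + 1"
        by simp
      ultimately show ?thesis by simp
    qed
    finally show ?thesis
      unfolding p2 using False by simp
  qed simp
qed

text \<open>\<open>progression a\<close> applies \<open>sec 0\<close> exactly \<open>2 a + 1\<close>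
  times, undoing that many dilations.\<close>

lemma progression_dil: "progression a ((dil ^^ (2 * a + 1)) g * f) = g * progression a f"
proof (induction a arbitrary: g)
  case 0
  show ?case
    by (simp add: sec_dil_mult mult.left_commute[of fps_X])
next
  case (Suc a)
  have "(dil ^^ (2 * Suc a + 1)) g = (dil ^^ (2 * a + 1)) (dil (dil g))"
    by (simp add: funpow_swap1)
  then show ?case
    using Suc.IH[of "dil (dil g)"] by (simp only: progression.simps sec_dil_mult mult.left_commute[of fps_X])
qed

lemma euler_E_power_3: "(dil ^^ k) (euler_E 1 ^ 3) = euler_E (3 ^ k) ^ 3"
  by (induction k) (simp_all add: dil_power euler_E_triple)

primrec T_series :: "nat \<Rightarrow> int fps" where
  "T_series 0 = sec 0 zeta"
| "T_series (Suc a) = sec 0 (zeta * sec 0 (T_series a))"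

text \<open>The exponent starts at 2 from \<open>9 * tau\<close>; each step adds 2 for
  \<open>sec 0\<close> and 1 for the extraction with \<open>zeta\<close>.\<close>

lemma T_series_lattice: "T_series a \<in> lattice (3 * a + 2)"
proof (induction a)
  case 0
  have "27 * sec 0 zeta = 3 ^ 2 * (27 * tau)"
    by (simp add: sec_0_zeta)
  then show ?case
    unfolding lattice_def T_series.simps mem_Collect_eq mult_0_right add_0
    by (blast intro: int_span_self)
next
  case (Suc a)
  have "3 * Suc a + 2 = 3 * a + 2 + 2 + 1" by simp
  then show ?case
    using sec_0_zeta_lattice[OF sec_0_lattice[OF Suc.IH]] by (simp only: T_series.simps)
qed

text \<open>\<open>E(q^3)^3\<close> enters \<open>sec 0\<close> as \<open>E(q^9)^3\<close>, which
  with \<open>fps_X\<close> becomes \<open>zeta E(q)^3\<close>. This \<open>E(q)^3\<close> cancels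
  \<open>u\<close> at the bottom, and otherwise enters the inner \<open>sec 0\<close> as the
  \<open>E(q^3)^3\<close> of the previous stage.\<close>

lemma progression_inverse:
  assumes "u * euler_E 1 ^ 3 = 1"
  shows "euler_E 3 ^ 3 * progression a u = T_series a"
proof -
  have E3: "euler_E 3 ^ 3 = dil (euler_E 1 ^ 3)" and E9: "euler_E 9 ^ 3 = dil (euler_E 3 ^ 3)"
    by (simp_all add: dil_power dil_euler_E[unfolded One_nat_def])
  have X: "fps_X * euler_E 9 ^ 3 * f = zeta * (euler_E 1 ^ 3 * f)" for f
    unfolding zeta_eq[symmetric] by (simp only: mult_ac)
  show ?thesis
  proof (induction a)
    case 0
    have "euler_E 3 ^ 3 * progression 0 u = sec 0 (fps_X * euler_E 9 ^ 3 * u)"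
      by (simp only: progression.simps E9 mult.assoc sec_dil_mult mult.left_commute[of fps_X])
    also have "\<dots> = sec 0 zeta"
      unfolding X using assms by (simp add: mult.commute)
    finally show ?case by simp
  next
    case (Suc a)
    have "euler_E 3 ^ 3 * progression (Suc a) u =
        sec 0 (fps_X * euler_E 9 ^ 3 * sec 0 (progression a u))"
      by (simp only: progression.simps E9 mult.assoc sec_dil_mult mult.left_commute[of fps_X])
    also have "\<dots> = sec 0 (zeta * sec 0 (euler_E 3 ^ 3 * progression a u))"
      unfolding X by (simp only: E3 sec_dil_mult)
    finally show ?case
      unfolding Suc.IH by simp
  qed
qed

lemma T_progression:
  assumes "n > 0"
  shows "int (T (3 ^ (2 * a + 2)) (3 ^ (2 * a + 1) * n - (3 ^ (2 * a + 2) - 1) div 8)) =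
           fps_nth (T_series a) n"
proof -
  let ?G = "Abs_fps (\<lambda>n. of_nat (T (3 ^ (2 * a + 2)) n)) :: int fps"
  define u :: "int fps" where "u = fps_left_inverse (euler_E 1 ^ 3) 1"
  have u: "u * euler_E 1 ^ 3 = 1"
    unfolding u_def by (rule left_inverse_euler_E)
  have "?G = ?G * euler_E 1 ^ 3 * u"
    using u by (simp only: mult.assoc mult.commute[of "euler_E 1 ^ 3"] mult_1_right)
  also have "\<dots> = euler_E (3 ^ (2 * a + 2)) ^ 3 * u"
    by (subst T_gf_mult) simp_all
  \<comment> \<open>Undoing \<open>2 a + 1\<close> of the \<open>2 a + 2\<close> dilations leaves
    the \<open>E(q^3)^3\<close> that \<open>progression_inverse\<close> absorbs.\<close>
  also have "euler_E (3 ^ (2 * a + 2)) ^ 3 = (dil ^^ (2 * a + 1)) (euler_E 3 ^ 3)"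
    unfolding euler_E_power_3[symmetric] dil_euler_E(1)[symmetric] dil_power[symmetric]
    by (simp add: funpow_swap1)
  finally have "progression a ?G = T_series a"
    by (simp only: progression_dil progression_inverse[OF u])
  then have "fps_nth (progression a ?G) n = fps_nth (T_series a) n"
    by (simp only:)
  then show ?thesis
    unfolding progression_nth using assms by simp
qed

lemma iterated_sec_0_lattice: "f \<in> lattice e \<Longrightarrow> (sec 0 ^^ b) f \<in> lattice (e + 2 * b)"
proof (induction b)
  case (Suc b)
  then show ?case using sec_0_lattice[of "(sec 0 ^^ b) f" "e + 2 * b"] by (simp add: add_ac)
qed simp

lemma iterated_sec_0_nth: "fps_nth ((sec 0 ^^ b) f) n = fps_nth f (3 ^ b * n)"
  by (induction b arbitrary: n) (simp_all add: mult_ac)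

theorem theorem1p2:
  fixes n \<alpha> \<beta> :: nat
  shows "[T (3 ^ (2 * \<alpha> + 2)) (3 ^ (2 * \<alpha> + \<beta> + 1) * (n + 1) - (3 ^ (2 * \<alpha> + 2) - 1) div 8) = 0]
           (mod 3 ^ (3 * \<alpha> + 2 * \<beta> + 2)) \<and>
         [T (3 ^ (2 * \<alpha> + 2)) (3 ^ (2 * \<alpha> + \<beta> + 1) * (3 * n + 2) - (3 ^ (2 * \<alpha> + 2) - 1) div 8) = 0]
           (mod 3 ^ (3 * \<alpha> + 2 * \<beta> + 3))"
proof -
  \<comment> \<open>Each further \<open>sec 0\<close> multiplies the index by 3 and gains a factor
    9, which accounts for \<open>\<beta>\<close> in argument and modulus.\<close>
  define f where "f = (sec 0 ^^ \<beta>) (T_series \<alpha>)"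
  have f: "f \<in> lattice (3 * \<alpha> + 2 * \<beta> + 2)"
    using iterated_sec_0_lattice[OF T_series_lattice[of \<alpha>], of \<beta>] by (simp add: f_def add_ac)
  have T: "int (T (3 ^ (2 * \<alpha> + 2)) (3 ^ (2 * \<alpha> + \<beta> + 1) * m - (3 ^ (2 * \<alpha> + 2) - 1) div 8)) = fps_nth f m"
    if "m > 0" for m
    using T_progression[of "3 ^ \<beta> * m" \<alpha>] that
    unfolding f_def iterated_sec_0_nth by (simp add: power_add mult_ac)
  have dvd: "[T l k = 0] (mod 3 ^ e)" if "3 ^ e dvd int (T l k)" for l k e
    using that unfolding cong_0_iff by (metis of_nat_dvd_iff of_nat_numeral of_nat_power)
  show ?thesis
  proof (intro conjI dvd)
    show "3 ^ (3 * \<alpha> + 2 * \<beta> + 2) dvd int (T (3 ^ (2 * \<alpha> + 2))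
        (3 ^ (2 * \<alpha> + \<beta> + 1) * (n + 1) - (3 ^ (2 * \<alpha> + 2) - 1) div 8))"
      by (subst T) (simp, rule lattice_nth(1)[OF f])
    have "3 * \<alpha> + 2 * \<beta> + 3 = 3 * \<alpha> + 2 * \<beta> + 2 + 1" by simp
    then show "3 ^ (3 * \<alpha> + 2 * \<beta> + 3) dvd int (T (3 ^ (2 * \<alpha> + 2))
        (3 ^ (2 * \<alpha> + \<beta> + 1) * (3 * n + 2) - (3 ^ (2 * \<alpha> + 2) - 1) div 8))"
      by (subst T) (simp, simp only: lattice_nth(2)[OF f])
  qed
qed

end
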